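(* Let $m\ge1$ be an integer, let $C>0$ and $\alpha\in(0,1)$ be fixed, and let $n=n_N$, $s=s_N$ (positive integers with $N=sn$) and $\lambda=\lambda_N>0$ depend on $N$, with $h=\lambda^{1/(2m)}$. Suppose that $h\to0$ and $n\to\infty$ as $N\to\infty$, and that $\lim_{N\to\infty}nh$ exists (it may be infinite). Let $\mathcal{B}=\{f\in S^m(\mathbb{I}):J(f)\le C\}$ and $d_{N,\lambda}=\sqrt{\lambda+n^{-2m}+\sigma_{N,\lambda}}$. Then for any $\varepsilon>0$ there exist $C_\varepsilon,N_\varepsilon>0$ such that for any $N\ge N_\varepsilon$, $$\inf_{\substack{f\in\mathcal{B}\\ \|f\|_2\ge C_\varepsilon d_{N,\lambda}}}P_f(\phi_{N,\lambda}=1)\ \ge\ 1-\varepsilon.$$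
   Context: Let $\mathbb{I}=[0,1]$ and let $m\ge1$ be an integer. For $k=1,2,\ldots$ put $\varphi_{2k-1}(t)=\sqrt2\cos(2\pi kt)$, $\varphi_{2k}(t)=\sqrt2\sin(2\pi kt)$, $\gamma_{2k-1}=\gamma_{2k}=(2\pi k)^{2m}$. The periodic Sobolev space is $$S^m(\mathbb{I})=\left\{\sum_{\nu=1}^\infty f_\nu\varphi_\nu(\cdot):\ f_\nu\in\mathbb{R},\ \sum_{\nu=1}^\infty f_\nu^2\gamma_\nu<\infty\right\}.$$ For $f,g\in S^m(\mathbb{I})$, $J(f,g)=\int_{\mathbb{I}} f^{(m)}(t)g^{(m)}(t)\,dt$ and $J(f)=J(f,f)$ (so $J(\sum_\nu f_\nu\varphi_\nu)=\sum_\nu f_\nu^2\gamma_\nu$). Also $\|f\|_2=\sqrt{\int_{\mathbb{I}}f(t)^2dt}$. Model: $y_l=f(l/N)+\epsilon_l$, $l=0,1,\ldots,N-1$, where $f\in S^m(\mathbb{I})$ and the $\epsilon_l$ are i.i.d. standard normal. $P_f$ denotes probability when $f$ is the true regression function. Distributed estimator: with $N=s\times n$, for $j=1,\ldots,s$ the $j$th machine receives $(Y_{i,j},t_{i,j})$, $i=1,\ldots,n$, where $Y_{i,j}=y_{is-s+j-1}$ and $t_{i,j}=(is-s+j-1)/N$. For a smoothing parameter $\lambda>0$, the $j$th sub-estimate is $$\widehat f_j=\arg\min_{g\in S^m(\mathbb{I})}\ \frac1{2n}\sum_{i=1}^n\bigl(Y_{i,j}-g(t_{i,j})\bigr)^2+\frac{\lambda}{2}J(g),$$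 and the averaged estimator is $\bar f=\frac1s\sum_{j=1}^s\widehat f_j$. Throughout $h=\lambda^{1/(2m)}$. Test of $H_0:f=0$ versus $H_1:f\in S^m(\mathbb{I})\setminus\{0\}$: $T_{N,\lambda}=\|\bar f\|_2^2$, $\mu_{N,\lambda}=E_{H_0}\{T_{N,\lambda}\}$, $\sigma_{N,\lambda}^2=\mathrm{Var}_{H_0}\{T_{N,\lambda}\}$, $\sigma_{N,\lambda}>0$ (computed when $f=0$), and the test is $$\phi_{N,\lambda}=I\bigl(|T_{N,\lambda}-\mu_{N,\lambda}|\ge z_{1-\alpha/2}\,\sigma_{N,\lambda}\bigr),$$ where $I(\cdot)$ is the indicator function, $1-\alpha$ is the pre-specified significance level and $z_{1-\alpha/2}$ is the $(1-\alpha/2)$-quantile of $N(0,1)$. *)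

theory Defs
  imports "HOL-Probability.Probability"
begin

section \<open>The periodic Sobolev space\<close>

text \<open>Trigonometric basis and eigenvalues, indexed by \<open>\<nu> \<ge> 1\<close>; the frequency of index
  \<open>\<nu> = 2k - 1\<close> and of index \<open>\<nu> = 2k\<close> is \<open>k = (\<nu> + 1) div 2\<close>.\<close>

definition trig_basis :: "nat \<Rightarrow> real \<Rightarrow> real" where
  "trig_basis \<nu> t =
     (if odd \<nu> then sqrt 2 * cos (2 * pi * real ((\<nu> + 1) div 2) * t)
      else sqrt 2 * sin (2 * pi * real ((\<nu> + 1) div 2) * t))"

definition trig_eigenvalue :: "nat \<Rightarrow> nat \<Rightarrow> real" where
  "trig_eigenvalue m \<nu> = (2 * pi * real ((\<nu> + 1) div 2)) ^ (2 * m)"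

text \<open>Functions on \<open>[0,1]\<close> are represented by total functions on the reals whose values outside
  \<open>[0,1]\<close> are irrelevant. The series are indexed by \<open>Suc \<nu>\<close> because \<open>sums\<close> starts at \<open>0\<close>; for
  \<open>m \<ge> 1\<close> the condition on the coefficients makes them absolutely and uniformly convergent.\<close>

definition sobolev :: "nat \<Rightarrow> (real \<Rightarrow> real) set" where
  "sobolev m = {f. \<exists>c :: nat \<Rightarrow> real.
     summable (\<lambda>\<nu>. (c (Suc \<nu>))\<^sup>2 * trig_eigenvalue m (Suc \<nu>)) \<and>
     (\<forall>t\<in>{0..1}. (\<lambda>\<nu>. c (Suc \<nu>) * trig_basis (Suc \<nu>) t) sums f t)}"

text \<open>\<open>has_deriv_I k f g\<close>: on \<open>[0,1]\<close>, \<open>g\<close> is a \<open>k\<close>-th derivative of \<open>f\<close> in the Sobolev sense, that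
  is, \<open>f\<close> is a \<open>k\<close>-fold iterated indefinite Lebesgue integral of \<open>g\<close> (each derivative of order below
  \<open>k\<close> is absolutely continuous). An element of the Sobolev space of order \<open>m\<close> need not have a
  classical \<open>m\<close>-th derivative at every point. Such a \<open>g\<close> is unique up to a null set, so the choice
  made in \<open>deriv_I\<close> does not affect integrals.\<close>

primrec has_deriv_I :: "nat \<Rightarrow> (real \<Rightarrow> real) \<Rightarrow> (real \<Rightarrow> real) \<Rightarrow> bool" where
  "has_deriv_I 0 f g \<longleftrightarrow> (\<forall>t\<in>{0..1}. f t = g t)"
| "has_deriv_I (Suc k) f g \<longleftrightarrow>
     (\<exists>f'. set_integrable lborel {0..1} f' \<and>
           (\<forall>t\<in>{0..1}. f t = f 0 + (LBINT u:{0..t}. f' u)) \<and>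
           has_deriv_I k f' g)"

definition deriv_I :: "nat \<Rightarrow> (real \<Rightarrow> real) \<Rightarrow> real \<Rightarrow> real" where
  "deriv_I k f = (SOME g. has_deriv_I k f g)"

definition J_form :: "nat \<Rightarrow> (real \<Rightarrow> real) \<Rightarrow> (real \<Rightarrow> real) \<Rightarrow> real" where
  "J_form m f g = (LBINT t:{0..1}. deriv_I m f t * deriv_I m g t)"

abbreviation J_pen :: "nat \<Rightarrow> (real \<Rightarrow> real) \<Rightarrow> real" where
  "J_pen m f \<equiv> J_form m f f"

definition L2norm_I :: "(real \<Rightarrow> real) \<Rightarrow> real" where
  "L2norm_I f = sqrt (LBINT t:{0..1}. (f t)\<^sup>2)"

section \<open>Divide-and-conquer smoothing spline\<close>

text \<open>Throughout, \<open>s\<close> is the number of machines, \<open>n\<close> the number of observations per machine, so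
  that the total sample size is \<open>s * n\<close>, and \<open>y\<close> is the full data vector, indexed from \<open>0\<close>.
  For \<open>i, j \<ge> 1\<close> the truncated subtraction in \<open>global_index\<close> is the ordinary one.\<close>

definition global_index :: "nat \<Rightarrow> nat \<Rightarrow> nat \<Rightarrow> nat" where
  "global_index s i j = i * s - s + j - 1"

definition design_point :: "nat \<Rightarrow> nat \<Rightarrow> nat \<Rightarrow> nat \<Rightarrow> real" where
  "design_point s n i j = real (global_index s i j) / real (s * n)"

definition local_objective ::
  "nat \<Rightarrow> real \<Rightarrow> nat \<Rightarrow> nat \<Rightarrow> (nat \<Rightarrow> real) \<Rightarrow> nat \<Rightarrow> (real \<Rightarrow> real) \<Rightarrow> real" where
  "local_objective m lam s n y j g =
     1 / (2 * real n) * (\<Sum>i=1..n. (y (global_index s i j) - g (design_point s n i j))\<^sup>2)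
     + lam / 2 * J_pen m g"

text \<open>For \<open>m, s, n \<ge> 1\<close> and \<open>lam > 0\<close> the minimizer is unique as a function on \<open>[0,1]\<close>.\<close>

definition sub_estimate ::
  "nat \<Rightarrow> real \<Rightarrow> nat \<Rightarrow> nat \<Rightarrow> (nat \<Rightarrow> real) \<Rightarrow> nat \<Rightarrow> real \<Rightarrow> real" where
  "sub_estimate m lam s n y j = arg_min (local_objective m lam s n y j) (\<lambda>g. g \<in> sobolev m)"

definition avg_estimate ::
  "nat \<Rightarrow> real \<Rightarrow> nat \<Rightarrow> nat \<Rightarrow> (nat \<Rightarrow> real) \<Rightarrow> real \<Rightarrow> real" where
  "avg_estimate m lam s n y t = 1 / real s * (\<Sum>j=1..s. sub_estimate m lam s n y j t)"

definition test_statistic :: "nat \<Rightarrow> real \<Rightarrow> nat \<Rightarrow> nat \<Rightarrow> (nat \<Rightarrow> real) \<Rightarrow> real" where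
  "test_statistic m lam s n y = (L2norm_I (avg_estimate m lam s n y))\<^sup>2"

section \<open>The regression model and the test\<close>

definition iid_std_normal :: "'a measure \<Rightarrow> nat \<Rightarrow> (nat \<Rightarrow> 'a \<Rightarrow> real) \<Rightarrow> bool" where
  "iid_std_normal M N eps \<longleftrightarrow>
     prob_space.indep_vars M (\<lambda>_. borel) eps {..<N} \<and>
     (\<forall>l<N. distributed M lborel (eps l) std_normal_density)"

definition observations ::
  "nat \<Rightarrow> (real \<Rightarrow> real) \<Rightarrow> (nat \<Rightarrow> 'a \<Rightarrow> real) \<Rightarrow> 'a \<Rightarrow> nat \<Rightarrow> real" where
  "observations N f eps \<omega> l = f (real l / real N) + eps l \<omega>"

text \<open>The test statistic as a random variable when \<open>f\<close> is the true regression function.\<close>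

definition T_stat ::
  "nat \<Rightarrow> real \<Rightarrow> nat \<Rightarrow> nat \<Rightarrow> (nat \<Rightarrow> 'a \<Rightarrow> real) \<Rightarrow> (real \<Rightarrow> real) \<Rightarrow> 'a \<Rightarrow> real" where
  "T_stat m lam s n eps f \<omega> = test_statistic m lam s n (observations (s * n) f eps \<omega>)"

definition null_mean ::
  "'a measure \<Rightarrow> nat \<Rightarrow> real \<Rightarrow> nat \<Rightarrow> nat \<Rightarrow> (nat \<Rightarrow> 'a \<Rightarrow> real) \<Rightarrow> real" where
  "null_mean M m lam s n eps = prob_space.expectation M (T_stat m lam s n eps (\<lambda>_. 0))"

definition null_sd ::
  "'a measure \<Rightarrow> nat \<Rightarrow> real \<Rightarrow> nat \<Rightarrow> nat \<Rightarrow> (nat \<Rightarrow> 'a \<Rightarrow> real) \<Rightarrow> real" where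
  "null_sd M m lam s n eps = sqrt (prob_space.variance M (T_stat m lam s n eps (\<lambda>_. 0)))"

definition std_normal_quantile :: "real \<Rightarrow> real" where
  "std_normal_quantile p = Inf {x. p \<le> cdf std_normal_distribution x}"

text \<open>The test as a \<open>0\<close>-\<open>1\<close>-valued random variable when \<open>f\<close> is the true regression function.\<close>

definition spline_test ::
  "'a measure \<Rightarrow> nat \<Rightarrow> real \<Rightarrow> real \<Rightarrow> nat \<Rightarrow> nat \<Rightarrow> (nat \<Rightarrow> 'a \<Rightarrow> real) \<Rightarrow> (real \<Rightarrow> real) \<Rightarrow> 'a \<Rightarrow> nat"
where
  "spline_test M m \<alpha> lam s n eps f \<omega> =
     of_bool (\<bar>T_stat m lam s n eps f \<omega> - null_mean M m lam s n eps\<bar>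
              \<ge> std_normal_quantile (1 - \<alpha> / 2) * null_sd M m lam s n eps)"

definition bandwidth :: "nat \<Rightarrow> real \<Rightarrow> real" where
  "bandwidth m lam = lam powr (1 / (2 * real m))"

definition separation_rate ::
  "'a measure \<Rightarrow> nat \<Rightarrow> real \<Rightarrow> nat \<Rightarrow> nat \<Rightarrow> (nat \<Rightarrow> 'a \<Rightarrow> real) \<Rightarrow> real" where
  "separation_rate M m lam s n eps =
     sqrt (lam + 1 / real n ^ (2 * m) + null_sd M m lam s n eps)"

definition sobolev_ball :: "nat \<Rightarrow> real \<Rightarrow> (real \<Rightarrow> real) set" where
  "sobolev_ball m C = {f \<in> sobolev m. J_pen m f \<le> C}"

end

theory Submission
  imports Defs
begin

text \<open>
  The estimator \<open>f\<^sub>b\<close> (the average of the sub-estimates) is linear in the data, so the statistic is a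
  positive semidefinite quadratic form \<open>T = y\<^sup>T G y\<close>. With the samples \<open>x = (f(l/N))\<^sub>l\<close> and the noise
  \<open>e\<close>,

    \<open>T - \<mu> = V + 2 (G x)\<^sup>T e + (e\<^sup>T G e - \<mu>)\<close>, where \<open>V = x\<^sup>T G x\<close>

  is the value of the statistic on noiseless data, and \<open>\<mu>\<close>, \<open>\<sigma>\<close> are the null mean and standard
  deviation. The last term has variance \<open>\<sigma>\<^sup>2 = 2 \<parallel>G\<parallel>\<^sup>2\<close> in the Frobenius norm, and the middle one has
  variance at most \<open>4 \<parallel>G\<parallel> V\<close>, because \<open>G\<close> is positive semidefinite. Both fluctuations are thus measured
  by \<open>\<sigma>\<close> itself, and by Chebyshev's inequality the test rejects with probability at least \<open>1 - \<epsilon>\<close> as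
  soon as \<open>V \<ge> D \<sigma>\<close> for a constant \<open>D\<close> that depends on \<open>\<alpha>\<close> and \<open>\<epsilon>\<close> only (\<open>gaussian_quad_form_power\<close>).

  It remains to bound \<open>V\<close> from below by the squared norm of \<open>f\<close>, up to the squared bias
  (\<open>avg_estimate_norm_lower\<close>). The bias is controlled by comparison: on noiseless data, each
  sub-estimate \<open>g\<close> competes with \<open>f\<close>, whose misfit is zero; hence \<open>J(g) \<le> J(f)\<close>, and the mean of
  \<open>(f - g)\<^sup>2\<close> over the \<open>n\<close> design points is at most \<open>\<lambda> J(f)\<close>. The sampling inequality

    \<open>\<parallel>u\<parallel>\<^sup>2 \<le> 4/n \<Sum>\<^sub>i u(t\<^sub>i)\<^sup>2 + 4\<^sup>m n\<^sup>-\<^sup>2\<^sup>m J(u)\<close>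

  for \<open>u = f - g\<close> (\<open>sampling_inequality\<close>) then gives a squared bias of order \<open>\<lambda> + n\<^sup>-\<^sup>2\<^sup>m\<close>, and
  averaging over the machines preserves the bound. For one derivative the sampling inequality
  compares \<open>u\<close> with its sampled value on each cell of length \<open>1/n\<close>; for \<open>m\<close> derivatives it follows by
  interpolation between frequencies, \<open>(\<omega>/n)\<^sup>2 \<le> 1/4 + 4\<^sup>m\<^sup>-\<^sup>1 (\<omega>/n)\<^sup>2\<^sup>m\<close>.

  All this takes place in the space of Fourier coefficients, and two facts lead there. The penalty,
  which is defined by weak derivatives, equals \<open>\<Sum> c\<^sup>2 \<omega>\<^sup>2\<^sup>m\<close> (\<open>J_pen_fourier\<close>): the derivative exists by
  Riesz--Fischer completeness and is unique almost everywhere. The minimizer exists, is unique on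
  \<open>[0,1]\<close> and linear in the data (\<open>sub_estimate_fourier\<close>): it is the combination of reproducing
  kernels whose weights solve the normal equations.
\<close>

section \<open>Quadratic forms in standard Gaussian noise\<close>

definition quad_form :: "nat \<Rightarrow> (nat \<Rightarrow> nat \<Rightarrow> real) \<Rightarrow> (nat \<Rightarrow> real) \<Rightarrow> real" where
  "quad_form N G x = (\<Sum>a<N. \<Sum>b<N. G a b * (x a * x b))"

definition frobenius :: "nat \<Rightarrow> (nat \<Rightarrow> nat \<Rightarrow> real) \<Rightarrow> real" where
  "frobenius N G = sqrt (\<Sum>a<N. \<Sum>b<N. (G a b)\<^sup>2)"

definition normal_moment :: "nat \<Rightarrow> real" where
  "normal_moment k = (LBINT x. std_normal_density x * x ^ k)"

lemma normal_moment_simps: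
  "normal_moment 0 = 1" "normal_moment (Suc 0) = 0" "normal_moment 2 = 1"
  "normal_moment 3 = 0" "normal_moment 4 = 3"
proof -
  have e: "normal_moment (2 * k) = fact (2 * k) / (2 ^ k * fact k)" for k
    unfolding normal_moment_def using integral_normal_moment_even[of 1 0 k] by simp
  have o: "normal_moment (2 * k + 1) = 0" for k
    unfolding normal_moment_def using integral_normal_moment_odd[of 1 0 k] by simp
  show "normal_moment 0 = 1" "normal_moment (Suc 0) = 0" "normal_moment 2 = 1"
    "normal_moment 3 = 0" "normal_moment 4 = 3"
    using e[of 0] o[of 0] e[of 1] o[of 1] e[of 2] by (auto simp: fact_numeral eval_nat_numeral)
qed

lemma (in prob_space) iid_normal_monomial:
  assumes iid: "iid_std_normal M N e"
  shows "has_bochner_integral M (\<lambda>\<omega>. \<Prod>l<N. e l \<omega> ^ k l) (\<Prod>l<N. normal_moment (k l))"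
proof -
  have dist: "distributed M lborel (e l) std_normal_density" if "l < N" for l
    using iid that by (simp add: iid_std_normal_def)
  have ind: "indep_vars (\<lambda>_. borel) e {..<N}"
    using iid by (simp add: iid_std_normal_def)
  have ind': "indep_vars (\<lambda>_. borel) (\<lambda>l \<omega>. e l \<omega> ^ k l) {..<N}"
    by (rule indep_vars_compose2[OF ind, where Y = "\<lambda>l x. x ^ k l"]) measurable
  have int: "integrable M (\<lambda>\<omega>. e l \<omega> ^ k l)" if "l < N" for l
  proof -
    have "integrable lborel (\<lambda>x. std_normal_density x * x ^ k l)"
      using integrable_normal_moment[of 1 0 "k l"] by simp
    then show ?thesis
      using distributed_integrable[OF dist[OF that], of "\<lambda>x. x ^ k l"] by simp
  qed
  have ex: "expectation (\<lambda>\<omega>. e l \<omega> ^ k l) = normal_moment (k l)" if "l < N" for l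
    using distributed_integral[OF dist[OF that], of "\<lambda>x. x ^ k l"]
    by (simp add: normal_moment_def)
  have "integrable M (\<lambda>\<omega>. \<Prod>l<N. e l \<omega> ^ k l)"
    by (rule indep_vars_integrable[OF _ ind']) (auto intro: int)
  moreover have "expectation (\<lambda>\<omega>. \<Prod>l<N. e l \<omega> ^ k l) = (\<Prod>l<N. normal_moment (k l))"
    using indep_vars_lebesgue_integral[OF _ ind'] int ex by simp
  ultimately show ?thesis by (simp add: has_bochner_integral_iff)
qed

text \<open>Writing a single variable as a monomial in all of them lets exponents add up where indices
  coincide, so that products of several variables need no separate treatment.\<close>

lemma prod_power_of_bool:
  fixes u :: "nat \<Rightarrow> real"
  assumes "a < N"
  shows "(\<Prod>l<N. u l ^ of_bool (l = a)) = u a"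
proof -
  have "(\<Prod>l<N. u l ^ of_bool (l = a)) = (\<Prod>l<N. if l = a then u l else 1)"
    by (intro prod.cong) auto
  then show ?thesis using assms by simp
qed

text \<open>Isserlis' formula: the expectation of a product of centred Gaussian variables is the sum, over
  all pairings of the factors, of the products of the covariances of the pairs.\<close>

lemma (in prob_space) iid_normal_moments:
  assumes iid: "iid_std_normal M N e"
  shows "a < N \<Longrightarrow> has_bochner_integral M (e a) 0"
    and "a < N \<Longrightarrow> b < N \<Longrightarrow> has_bochner_integral M (\<lambda>\<omega>. e a \<omega> * e b \<omega>) (of_bool (a = b))"
    and "a < N \<Longrightarrow> b < N \<Longrightarrow> c < N \<Longrightarrow> d < N \<Longrightarrow>
      has_bochner_integral M (\<lambda>\<omega>. e a \<omega> * e b \<omega> * (e c \<omega> * e d \<omega>))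
        (of_bool (a = b \<and> c = d) + of_bool (a = c \<and> b = d) + of_bool (a = d \<and> b = c))"
proof -
  have nums: "Suc (Suc 0) = 2" "Suc 2 = 3" "Suc 3 = 4" by auto
  { assume a: "a < N"
    have eq: "(\<Prod>l<N. e l \<omega> ^ of_bool (l = a)) = e a \<omega>" for \<omega>
      by (rule prod_power_of_bool[OF a])
    have "(\<Prod>l<N. normal_moment (of_bool (l = a))) = (\<Prod>l\<in>{a}. normal_moment (of_bool (l = a)))"
      using a by (intro prod.mono_neutral_right) (auto simp: normal_moment_simps)
    then have "(\<Prod>l<N. normal_moment (of_bool (l = a))) = 0"
      by (simp add: normal_moment_simps)
    then show "has_bochner_integral M (e a) 0"
      using iid_normal_monomial[OF iid, of "\<lambda>l. of_bool (l = a)"] by (simp only: eq)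
  }
  { assume a: "a < N" "b < N"
    let ?k = "\<lambda>l. of_bool (l = a) + of_bool (l = b)"
    have eq: "(\<Prod>l<N. e l \<omega> ^ ?k l) = e a \<omega> * e b \<omega>" for \<omega>
      by (simp only: power_add prod.distrib prod_power_of_bool a)
    have "(\<Prod>l<N. normal_moment (?k l)) = (\<Prod>l\<in>{a,b}. normal_moment (?k l))"
      using a by (intro prod.mono_neutral_right) (auto simp: normal_moment_simps)
    also have "\<dots> = of_bool (a = b)"
      by (cases "a = b") (simp_all add: normal_moment_simps nums prod.insert_if)
    finally show "has_bochner_integral M (\<lambda>\<omega>. e a \<omega> * e b \<omega>) (of_bool (a = b))"
      using iid_normal_monomial[OF iid, of ?k] by (simp only: eq)
  }
  { assume a: "a < N" "b < N" "c < N" "d < N"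
    let ?k = "\<lambda>l. of_bool (l = a) + of_bool (l = b) + (of_bool (l = c) + of_bool (l = d))"
    have eq: "(\<Prod>l<N. e l \<omega> ^ ?k l) = e a \<omega> * e b \<omega> * (e c \<omega> * e d \<omega>)" for \<omega>
      by (simp only: power_add prod.distrib prod_power_of_bool a)
    have "(\<Prod>l<N. normal_moment (?k l)) = (\<Prod>l\<in>{a,b,c,d}. normal_moment (?k l))"
      using a by (intro prod.mono_neutral_right) (auto simp: normal_moment_simps)
    also have "\<dots> = of_bool (a = b \<and> c = d) + of_bool (a = c \<and> b = d) + of_bool (a = d \<and> b = c)"
      \<comment> \<open>the patterns of coincidence among the four indices\<close>
      by (cases "a = b"; cases "a = c"; cases "a = d"; cases "b = c"; cases "b = d"; cases "c = d")
         (simp_all add: normal_moment_simps nums prod.insert_if)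
    finally show "has_bochner_integral M (\<lambda>\<omega>. e a \<omega> * e b \<omega> * (e c \<omega> * e d \<omega>))
        (of_bool (a = b \<and> c = d) + of_bool (a = c \<and> b = d) + of_bool (a = d \<and> b = c))"
      using iid_normal_monomial[OF iid, of ?k] by (simp only: eq)
  }
qed

lemma sum_of_bool_pair:
  fixes F :: "nat \<Rightarrow> nat \<Rightarrow> real"
  assumes "a < N" "b < N"
  shows "(\<Sum>c<N. \<Sum>d<N. F c d * of_bool (c = a \<and> d = b)) = F a b"
proof -
  have "(\<Sum>c<N. \<Sum>d<N. F c d * of_bool (c = a \<and> d = b)) =
    (\<Sum>c<N. if c = a then (\<Sum>d<N. if d = b then F c d else 0) else 0)"
    by (intro sum.cong) (auto intro: sum.cong)
  then show ?thesis using assms by simp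
qed

text \<open>In the second moment, the pairing that keeps each of the two copies of the form to itself
  contributes the squared mean, and each of the other two contributes the squared Frobenius norm.\<close>

lemma (in prob_space) gaussian_quad_form:
  assumes iid: "iid_std_normal M N e" and sym: "\<And>a b. G a b = G b a"
  defines "Q \<equiv> \<lambda>\<omega>. quad_form N G (\<lambda>l. e l \<omega>)"
  shows "integrable M Q" "integrable M (\<lambda>\<omega>. (Q \<omega>)\<^sup>2)" "variance Q = 2 * (frobenius N G)\<^sup>2"
proof -
  note mom = iid_normal_moments[OF iid]
  have "has_bochner_integral M Q (\<Sum>a<N. \<Sum>b<N. G a b * of_bool (a = b))"
    unfolding Q_def quad_form_def
    by (intro has_bochner_integral_sum has_bochner_integral_mult_right mom) auto
  moreover have "(\<Sum>a<N. \<Sum>b<N. G a b * of_bool (a = b)) = (\<Sum>a<N. \<Sum>b<N. if a = b then G a b else 0)"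
    by (intro sum.cong) auto
  ultimately have "has_bochner_integral M Q (\<Sum>a<N. G a a)" by simp
  then have int1: "integrable M Q" and E1: "expectation Q = (\<Sum>a<N. G a a)"
    by (auto simp: has_bochner_integral_iff)
  show "integrable M Q" by (rule int1)
  have sq: "(Q \<omega>)\<^sup>2 = (\<Sum>a<N. \<Sum>b<N. \<Sum>c<N. \<Sum>d<N.
      (G a b * G c d) * (e a \<omega> * e b \<omega> * (e c \<omega> * e d \<omega>)))" for \<omega>
    unfolding Q_def quad_form_def power2_eq_square sum_distrib_right
    unfolding sum_distrib_left
    by (intro sum.cong refl) (simp add: ac_simps)
  have "has_bochner_integral M (\<lambda>\<omega>. (Q \<omega>)\<^sup>2) (\<Sum>a<N. \<Sum>b<N. \<Sum>c<N. \<Sum>d<N. (G a b * G c d) *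
      (of_bool (a = b \<and> c = d) + of_bool (a = c \<and> b = d) + of_bool (a = d \<and> b = c)))"
    unfolding sq
    by (intro has_bochner_integral_sum has_bochner_integral_mult_right mom) auto
  then have int2: "integrable M (\<lambda>\<omega>. (Q \<omega>)\<^sup>2)" and
    E: "expectation (\<lambda>\<omega>. (Q \<omega>)\<^sup>2) = (\<Sum>a<N. \<Sum>b<N. \<Sum>c<N. \<Sum>d<N. (G a b * G c d) *
      (of_bool (a = b \<and> c = d) + of_bool (a = c \<and> b = d) + of_bool (a = d \<and> b = c)))"
    by (auto simp: has_bochner_integral_iff)
  show "integrable M (\<lambda>\<omega>. (Q \<omega>)\<^sup>2)" by (rule int2)
  have "expectation (\<lambda>\<omega>. (Q \<omega>)\<^sup>2) = (\<Sum>a<N. \<Sum>b<N. \<Sum>c<N. \<Sum>d<N. (G a b * G c d) *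
      (of_bool (a = b \<and> c = d) + of_bool (a = c \<and> b = d) + of_bool (a = d \<and> b = c)))"
    by (rule E)
  also have "\<dots> = (\<Sum>a<N. \<Sum>b<N. of_bool (a = b) * G a b * (\<Sum>c<N. G c c)
      + (\<Sum>c<N. \<Sum>d<N. G a b * G c d * of_bool (c = a \<and> d = b))
      + (\<Sum>c<N. \<Sum>d<N. G a b * G c d * of_bool (c = b \<and> d = a)))"
  proof (intro sum.cong refl)
    fix a b
    have "(\<Sum>c<N. \<Sum>d<N. (G a b * G c d) * of_bool (a = b \<and> c = d))
      = of_bool (a = b) * G a b * (\<Sum>c<N. \<Sum>d<N. if c = d then G c d else 0)"
      unfolding sum_distrib_left by (intro sum.cong) auto
    then have 1: "(\<Sum>c<N. \<Sum>d<N. (G a b * G c d) * of_bool (a = b \<and> c = d))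
      = of_bool (a = b) * G a b * (\<Sum>c<N. G c c)" by simp
    have 2: "(a = c \<and> b = d) = (c = a \<and> d = b)" "(a = d \<and> b = c) = (c = b \<and> d = a)" for c d
      by auto
    show "(\<Sum>c<N. \<Sum>d<N. (G a b * G c d) *
        (of_bool (a = b \<and> c = d) + of_bool (a = c \<and> b = d) + of_bool (a = d \<and> b = c)))
      = of_bool (a = b) * G a b * (\<Sum>c<N. G c c)
      + (\<Sum>c<N. \<Sum>d<N. G a b * G c d * of_bool (c = a \<and> d = b))
      + (\<Sum>c<N. \<Sum>d<N. G a b * G c d * of_bool (c = b \<and> d = a))"
      unfolding distrib_left sum.distrib 1 2
      by (intro arg_cong2[where f = "(+)"] refl sum.cong) auto
  qed
  also have "\<dots> = (\<Sum>a<N. \<Sum>b<N. of_bool (a = b) * G a b * (\<Sum>c<N. G c c) + G a b * G a b + G a b * G b a)"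
    by (intro sum.cong refl) (simp only: lessThan_iff sum_of_bool_pair)
  also have "\<dots> = (\<Sum>a<N. \<Sum>b<N. (if a = b then G a b * (\<Sum>c<N. G c c) else 0)) + 2 * (\<Sum>a<N. \<Sum>b<N. (G a b)\<^sup>2)"
    unfolding sum.distrib[symmetric] sum_distrib_left
    by (intro sum.cong refl) (auto simp: power2_eq_square sym)
  also have "(\<Sum>a<N. \<Sum>b<N. (if a = b then G a b * (\<Sum>c<N. G c c) else 0)) = (\<Sum>a<N. G a a)\<^sup>2"
    by (simp add: power2_eq_square sum_distrib_right)
  finally have E2: "expectation (\<lambda>\<omega>. (Q \<omega>)\<^sup>2) = (\<Sum>a<N. G a a)\<^sup>2 + 2 * (\<Sum>a<N. \<Sum>b<N. (G a b)\<^sup>2)" .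
  show "variance Q = 2 * (frobenius N G)\<^sup>2"
    using variance_eq[OF int1 int2] E1 E2 by (simp add: frobenius_def sum_nonneg)
qed

lemma (in prob_space) gaussian_linear_form:
  fixes v :: "nat \<Rightarrow> real"
  assumes iid: "iid_std_normal M N e"
  defines "L \<equiv> \<lambda>\<omega>. \<Sum>l<N. v l * e l \<omega>"
  shows "integrable M L" "integrable M (\<lambda>\<omega>. (L \<omega>)\<^sup>2)" "expectation L = 0"
    and "variance L = (\<Sum>l<N. (v l)\<^sup>2)"
proof -
  note mom = iid_normal_moments[OF iid]
  have "has_bochner_integral M L (\<Sum>l<N. v l * 0)"
    unfolding L_def
    by (intro has_bochner_integral_sum has_bochner_integral_mult_right mom) auto
  then show "integrable M L" and E1: "expectation L = 0"
    by (auto simp: has_bochner_integral_iff)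
  have sq: "(L \<omega>)\<^sup>2 = (\<Sum>a<N. \<Sum>b<N. (v a * v b) * (e a \<omega> * e b \<omega>))" for \<omega>
    unfolding L_def power2_eq_square sum_product by (intro sum.cong refl) (simp add: ac_simps)
  have "has_bochner_integral M (\<lambda>\<omega>. (L \<omega>)\<^sup>2) (\<Sum>a<N. \<Sum>b<N. (v a * v b) * of_bool (a = b))"
    unfolding sq
    by (intro has_bochner_integral_sum has_bochner_integral_mult_right mom) auto
  moreover have "(\<Sum>a<N. \<Sum>b<N. (v a * v b) * of_bool (a = b)) = (\<Sum>a<N. \<Sum>b<N. if a = b then v a * v b else 0)"
    by (intro sum.cong) auto
  ultimately have "has_bochner_integral M (\<lambda>\<omega>. (L \<omega>)\<^sup>2) (\<Sum>l<N. (v l)\<^sup>2)"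
    by (simp add: power2_eq_square)
  then show "integrable M (\<lambda>\<omega>. (L \<omega>)\<^sup>2)" and "variance L = (\<Sum>l<N. (v l)\<^sup>2)"
    using E1 by (auto simp: has_bochner_integral_iff)
qed

lemma quad_form_le_frobenius:
  "quad_form N G v \<le> frobenius N G * (\<Sum>a<N. (v a)\<^sup>2)"
proof -
  let ?S = "{..<N} \<times> {..<N}"
  have "(quad_form N G v)\<^sup>2 = (\<Sum>(a, b)\<in>?S. G a b * (v a * v b))\<^sup>2"
    by (simp add: quad_form_def sum.cartesian_product)
  also have "\<dots> \<le> (\<Sum>(a, b)\<in>?S. (G a b)\<^sup>2) * (\<Sum>(a, b)\<in>?S. (v a * v b)\<^sup>2)"
    using Cauchy_Schwarz_ineq_sum[of "\<lambda>(a, b). G a b" "\<lambda>(a, b). v a * v b" ?S]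
    by (simp add: case_prod_beta)
  also have "(\<Sum>(a, b)\<in>?S. (v a * v b)\<^sup>2) = (\<Sum>a<N. (v a)\<^sup>2)\<^sup>2"
    by (simp add: sum.cartesian_product[symmetric] power_mult_distrib power2_eq_square[of "sum _ _"] sum_product)
  also have "(\<Sum>(a, b)\<in>?S. (G a b)\<^sup>2) = (frobenius N G)\<^sup>2"
    by (simp add: frobenius_def sum.cartesian_product[symmetric] sum_nonneg)
  finally have "(quad_form N G v)\<^sup>2 \<le> (frobenius N G * (\<Sum>a<N. (v a)\<^sup>2))\<^sup>2"
    by (simp add: power_mult_distrib)
  moreover have "0 \<le> frobenius N G * (\<Sum>a<N. (v a)\<^sup>2)"
    by (simp add: frobenius_def sum_nonneg)
  ultimately show ?thesis by (rule power2_le_imp_le)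
qed

lemma quad_form_add:
  assumes sym: "\<And>a b. G a b = G b a"
  shows "quad_form N G (\<lambda>l. x l + t * y l) =
    quad_form N G x + 2 * t * (\<Sum>a<N. (\<Sum>b<N. G a b * x b) * y a) + t\<^sup>2 * quad_form N G y"
proof -
  have 1: "(\<Sum>a<N. \<Sum>b<N. G a b * (x a * y b)) = (\<Sum>a<N. \<Sum>b<N. G a b * (y a * x b))"
    by (subst sum.swap) (simp add: sym mult.commute)
  have "quad_form N G (\<lambda>l. x l + t * y l) = quad_form N G x
     + t * (\<Sum>a<N. \<Sum>b<N. G a b * (x a * y b)) + t * (\<Sum>a<N. \<Sum>b<N. G a b * (y a * x b))
     + t\<^sup>2 * quad_form N G y"
    unfolding quad_form_def sum_distrib_left sum.distrib[symmetric]
    by (intro sum.cong refl) (simp add: algebra_simps power2_eq_square)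
  then show ?thesis unfolding 1 by (simp add: sum_distrib_left ac_simps)
qed

text \<open>If \<open>G = B\<^sup>T B\<close>, then \<open>\<parallel>G x\<parallel>\<^sup>2 \<le> \<parallel>B\<parallel>\<^sup>2 \<parallel>B x\<parallel>\<^sup>2\<close>, and the operator norm of \<open>G\<close> is at most its
  Frobenius norm. The proof avoids the square root of \<open>G\<close>: it uses that the form is nonnegative at
  \<open>x - v / F\<close> for \<open>v = G x\<close> and \<open>F\<close> the Frobenius norm.\<close>

lemma psd_image_norm_le:
  assumes sym: "\<And>a b. G a b = G b a" and psd: "\<And>v. 0 \<le> quad_form N G v"
    and pos: "0 < frobenius N G"
  shows "(\<Sum>a<N. (\<Sum>b<N. G a b * x b)\<^sup>2) \<le> frobenius N G * quad_form N G x"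
proof -
  define v where "v = (\<lambda>a. \<Sum>b<N. G a b * x b)"
  define F where "F = frobenius N G"
  define W where "W = (\<Sum>a<N. (v a)\<^sup>2)"
  have "0 \<le> quad_form N G (\<lambda>l. x l + (- 1 / F) * v l)" by (rule psd)
  also have "\<dots> = quad_form N G x - 2 / F * W + (1 / F)\<^sup>2 * quad_form N G v"
    unfolding quad_form_add[where G = G, OF sym] by (simp add: v_def W_def power2_eq_square[of "sum _ _"])
  also have "\<dots> \<le> quad_form N G x - 2 / F * W + (1 / F)\<^sup>2 * (F * W)"
    unfolding F_def W_def by (intro add_left_mono mult_left_mono quad_form_le_frobenius) auto
  also have "\<dots> = quad_form N G x - W / F"
    using pos by (simp add: F_def power2_eq_square field_simps)
  finally have "W \<le> F * quad_form N G x"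
    using pos by (simp add: F_def field_simps)
  then show ?thesis by (simp add: W_def v_def F_def)
qed

text \<open>The part linear in the noise is twice a variable of variance at most \<open>\<sigma> V\<close>, where \<open>V\<close> is the form at
  the signal; the part quadratic in the noise has variance \<open>\<sigma>\<^sup>2\<close>. So both fluctuations are small against \<open>V\<close> once \<open>V\<close> is a large multiple of \<open>\<sigma>\<close>. In that
  multiple, \<open>4 \<bar>z\<bar>\<close> keeps the threshold below \<open>V / 4\<close>, and \<open>32 / \<epsilon>\<close> makes each of the two Chebyshev
  bounds at most \<open>\<epsilon> / 2\<close>.\<close>

lemma (in prob_space) gaussian_quad_form_power:
  assumes iid: "iid_std_normal M N e" and sym: "\<And>a b. G a b = G b a"
    and psd: "\<And>v. 0 \<le> quad_form N G v"
    and \<epsilon>: "0 < \<epsilon>"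
  defines "Q \<equiv> \<lambda>\<omega>. quad_form N G (\<lambda>l. e l \<omega>)"
  assumes signal: "(4 * \<bar>z\<bar> + 32 / \<epsilon> + 1) * sqrt (variance Q) \<le> quad_form N G x"
  shows "1 - \<epsilon> \<le> prob {\<omega> \<in> space M. z * sqrt (variance Q) \<le>
      \<bar>quad_form N G (\<lambda>l. x l + e l \<omega>) - expectation Q\<bar>}"
proof (cases "variance Q = 0")
  case True
  \<comment> \<open>The threshold is zero, so the test always rejects.\<close>
  then show ?thesis using \<epsilon> by (simp add: prob_space)
next
  case False
  define \<sigma> where "\<sigma> = sqrt (variance Q)"
  define F where "F = frobenius N G"
  define V where "V = quad_form N G x"
  define D where "D = 4 * \<bar>z\<bar> + 32 / \<epsilon> + 1"
  define v where "v = (\<lambda>a. \<Sum>b<N. G a b * x b)"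
  define L where "L = (\<lambda>\<omega>. \<Sum>l<N. v l * e l \<omega>)"
  have Q: "integrable M Q" "integrable M (\<lambda>\<omega>. (Q \<omega>)\<^sup>2)" "variance Q = 2 * (frobenius N G)\<^sup>2"
    using gaussian_quad_form[where G = G, OF iid sym] unfolding Q_def by auto
  have L: "integrable M L" "integrable M (\<lambda>\<omega>. (L \<omega>)\<^sup>2)" "expectation L = 0"
    "variance L = (\<Sum>l<N. (v l)\<^sup>2)"
    using gaussian_linear_form[OF iid, of v] unfolding L_def by auto
  have F0: "0 \<le> F" by (simp add: F_def frobenius_def sum_nonneg)
  have "F \<noteq> 0" using False Q(3) by (auto simp: F_def)
  then have Fpos: "0 < F" using F0 by simp
  have \<sigma>2: "\<sigma>\<^sup>2 = variance Q" "variance Q = 2 * F\<^sup>2"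
    unfolding \<sigma>_def using Q(3) by (auto simp: F_def)
  have F\<sigma>: "F \<le> \<sigma>"
    by (rule power2_le_imp_le) (use \<sigma>2 in \<open>auto simp: \<sigma>_def\<close>)
  then have \<sigma>: "0 < \<sigma>" using Fpos by simp
  have D: "1 \<le> D" "4 * z \<le> D" "32 / \<epsilon> \<le> D"
    using divide_pos_pos[of 32 \<epsilon>] \<epsilon> abs_ge_self[of z] abs_ge_zero[of z] unfolding D_def by linarith+
  have V: "D * \<sigma> \<le> V" using signal by (simp add: D_def V_def \<sigma>_def)
  have Vpos: "0 < V"
    using V D \<sigma> by (meson less_le_trans mult_pos_pos zero_less_one)
  have split: "quad_form N G (\<lambda>l. x l + e l \<omega>) = V + 2 * L \<omega> + Q \<omega>" for \<omega>
    using quad_form_add[where G = G and N = N and x = x and t = 1 and y = "\<lambda>l. e l \<omega>", OF sym] by (simp add: V_def L_def v_def Q_def)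
  let ?A = "{\<omega> \<in> space M. V / 4 \<le> \<bar>L \<omega> - expectation L\<bar>}"
  let ?B = "{\<omega> \<in> space M. V / 4 \<le> \<bar>Q \<omega> - expectation Q\<bar>}"
  let ?T = "{\<omega> \<in> space M. z * \<sigma> \<le> \<bar>quad_form N G (\<lambda>l. x l + e l \<omega>) - expectation Q\<bar>}"
  have [measurable]: "random_variable borel Q" "random_variable borel L"
    using Q(1) L(1) by auto
  have "variance L \<le> F * V"
    unfolding L(4) using psd_image_norm_le[where G = G and x = x, OF sym psd] Fpos by (simp add: F_def V_def v_def)
  also have "\<dots> \<le> \<sigma> * V" using F\<sigma> Vpos by simp
  finally have varL: "variance L \<le> \<sigma> * V" .
  have "prob ?A \<le> variance L / (V / 4)\<^sup>2"
    by (rule Chebyshev_inequality) (use L(2) Vpos in auto)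
  also have "\<dots> \<le> \<sigma> * V / (V / 4)\<^sup>2" using varL by (intro divide_right_mono) auto
  also have "\<dots> = 16 * (\<sigma> / V)" using Vpos by (simp add: power2_eq_square field_simps)
  finally have pA: "prob ?A \<le> 16 * (\<sigma> / V)" .
  have \<sigma>V: "\<sigma> / V \<le> 1 / D" using V Vpos D by (simp add: field_simps)
  have "prob ?B \<le> variance Q / (V / 4)\<^sup>2"
    by (rule Chebyshev_inequality) (use Q(2) Vpos in auto)
  also have "\<dots> = 16 * (\<sigma> / V) * (\<sigma> / V)" using \<sigma>2(1) by (simp add: power2_eq_square)
  also have "\<dots> \<le> 16 * (\<sigma> / V) * 1"
  proof (rule mult_left_mono)
    have "1 / D \<le> 1" using D by simp
    then show "\<sigma> / V \<le> 1" using \<sigma>V by linarith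
  qed (use \<sigma> Vpos in auto)
  finally have pB: "prob ?B \<le> 16 * (\<sigma> / V)" by simp
  have "1 / D \<le> \<epsilon> / 32" using D \<epsilon> by (simp add: field_simps)
  then have bound: "16 * (\<sigma> / V) \<le> \<epsilon> / 2" using \<sigma>V by linarith
  have [measurable]: "?T \<in> events" unfolding split by measurable
  have "space M - (?A \<union> ?B) \<subseteq> ?T"
  proof
    fix \<omega> assume w: "\<omega> \<in> space M - (?A \<union> ?B)"
    have "\<bar>L \<omega>\<bar> < V / 4" "\<bar>Q \<omega> - expectation Q\<bar> < V / 4" using w L(3) by auto
    then have "V / 4 \<le> quad_form N G (\<lambda>l. x l + e l \<omega>) - expectation Q"
      unfolding split by linarith
    moreover have "z * \<sigma> \<le> V / 4"
    proof -
      have "(4 * z) * \<sigma> \<le> D * \<sigma>" using D \<sigma> by (intro mult_right_mono) auto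
      then show ?thesis using V by simp
    qed
    ultimately show "\<omega> \<in> ?T" using w by auto
  qed
  then have "prob (space M - (?A \<union> ?B)) \<le> prob ?T"
    by (intro finite_measure_mono) auto
  moreover have "prob (space M - (?A \<union> ?B)) = 1 - prob (?A \<union> ?B)"
    by (intro prob_compl) measurable
  moreover have "prob (?A \<union> ?B) \<le> prob ?A + prob ?B"
    by (intro measure_Un_le) measurable
  ultimately show ?thesis
    using pA pB bound unfolding \<sigma>_def by linarith
qed

section \<open>Mean-square limits\<close>

definition L2_limit :: "'a measure \<Rightarrow> (nat \<Rightarrow> 'a \<Rightarrow> real) \<Rightarrow> ('a \<Rightarrow> real) \<Rightarrow> bool" where
  "L2_limit M S h \<longleftrightarrow> h \<in> borel_measurable M \<and> integrable M (\<lambda>x. (h x)\<^sup>2) \<and>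
     (\<lambda>n. \<integral>x. (h x - S n x)\<^sup>2 \<partial>M) \<longlonglongrightarrow> 0"

lemma integrable_square_add:
  fixes f g :: "'a \<Rightarrow> real"
  assumes [measurable]: "f \<in> borel_measurable M" "g \<in> borel_measurable M"
    and "integrable M (\<lambda>x. (f x)\<^sup>2)" "integrable M (\<lambda>x. (g x)\<^sup>2)"
  shows "integrable M (\<lambda>x. (f x + g x)\<^sup>2)"
proof (rule Bochner_Integration.integrable_bound)
  show "integrable M (\<lambda>x. 2 * (f x)\<^sup>2 + 2 * (g x)\<^sup>2)"
    using assms by simp
  show "AE x in M. norm ((f x + g x)\<^sup>2) \<le> norm (2 * (f x)\<^sup>2 + 2 * (g x)\<^sup>2)"
  proof (rule AE_I2)
    fix x
    have "(f x + g x)\<^sup>2 + (f x - g x)\<^sup>2 = 2 * (f x)\<^sup>2 + 2 * (g x)\<^sup>2"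
      by (simp add: power2_eq_square algebra_simps)
    then have "(f x + g x)\<^sup>2 \<le> 2 * (f x)\<^sup>2 + 2 * (g x)\<^sup>2"
      using zero_le_power2[of "f x - g x"] by linarith
    then show "norm ((f x + g x)\<^sup>2) \<le> norm (2 * (f x)\<^sup>2 + 2 * (g x)\<^sup>2)"
      by simp
  qed
qed measurable

lemma integrable_square_diff:
  fixes f g :: "'a \<Rightarrow> real"
  assumes [measurable]: "f \<in> borel_measurable M" "g \<in> borel_measurable M"
    and "integrable M (\<lambda>x. (f x)\<^sup>2)" "integrable M (\<lambda>x. (g x)\<^sup>2)"
  shows "integrable M (\<lambda>x. (f x - g x)\<^sup>2)"
proof -
  have "integrable M (\<lambda>x. (f x + - g x)\<^sup>2)"
    by (rule integrable_square_add) (use assms in auto)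
  then show ?thesis by simp
qed

text \<open>The weighted inequality \<open>(u + v)\<^sup>2 \<le> (1 + \<delta>) u\<^sup>2 + (1 + 1/\<delta>) v\<^sup>2\<close> replaces the triangle
  inequality in \<open>L\<^sup>2\<close>.\<close>

lemma integral_square_le_weighted:
  fixes f g :: "'a \<Rightarrow> real"
  assumes [measurable]: "f \<in> borel_measurable M" "g \<in> borel_measurable M"
    and fi: "integrable M (\<lambda>x. (f x)\<^sup>2)" and gi: "integrable M (\<lambda>x. (g x)\<^sup>2)" and \<delta>: "0 < \<delta>"
  shows "(\<integral>x. (f x)\<^sup>2 \<partial>M) \<le> (1 + \<delta>) * (\<integral>x. (g x)\<^sup>2 \<partial>M) + (1 + 1 / \<delta>) * (\<integral>x. (f x - g x)\<^sup>2 \<partial>M)"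
proof -
  note di = integrable_square_diff[OF assms(1,2) fi gi]
  have "(f x)\<^sup>2 \<le> (1 + \<delta>) * (g x)\<^sup>2 + (1 + 1 / \<delta>) * (f x - g x)\<^sup>2" for x
  proof -
    define d where "d = f x - g x"
    have "0 \<le> (\<delta> * g x - d)\<^sup>2 / \<delta>" using \<delta> by simp
    also have "\<dots> = \<delta> * (g x)\<^sup>2 - 2 * g x * d + d\<^sup>2 / \<delta>"
      using \<delta> by (simp add: power2_eq_square field_simps)
    finally have "2 * g x * d \<le> \<delta> * (g x)\<^sup>2 + d\<^sup>2 / \<delta>" by simp
    moreover have "(f x)\<^sup>2 = (g x)\<^sup>2 + 2 * g x * d + d\<^sup>2"
      by (simp add: d_def power2_eq_square algebra_simps)
    ultimately show ?thesis unfolding d_def[symmetric] by (simp add: distrib_right)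
  qed
  then have "(\<integral>x. (f x)\<^sup>2 \<partial>M) \<le> (\<integral>x. (1 + \<delta>) * (g x)\<^sup>2 + (1 + 1 / \<delta>) * (f x - g x)\<^sup>2 \<partial>M)"
    by (intro integral_mono) (auto simp: fi gi di)
  then show ?thesis using gi di by simp
qed

text \<open>The weighted inequality is applied in both directions, and then \<open>\<delta>\<close> tends to zero.\<close>

lemma L2_limit_norm:
  assumes lim: "L2_limit M S h"
    and [measurable]: "\<And>n. S n \<in> borel_measurable M" and Si: "\<And>n. integrable M (\<lambda>x. (S n x)\<^sup>2)"
    and A: "(\<lambda>n. \<integral>x. (S n x)\<^sup>2 \<partial>M) \<longlonglongrightarrow> A"
  shows "(\<integral>x. (h x)\<^sup>2 \<partial>M) = A"
proof -
  have [measurable]: "h \<in> borel_measurable M" and hi: "integrable M (\<lambda>x. (h x)\<^sup>2)"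
    and E: "(\<lambda>n. \<integral>x. (h x - S n x)\<^sup>2 \<partial>M) \<longlonglongrightarrow> 0"
    using lim by (auto simp: L2_limit_def)
  define H where "H = (\<integral>x. (h x)\<^sup>2 \<partial>M)"
  have 1: "H \<le> (1 + \<delta>) * A" if "0 < \<delta>" for \<delta>
  proof (rule LIMSEQ_le_const)
    show "(\<lambda>n. (1 + \<delta>) * (\<integral>x. (S n x)\<^sup>2 \<partial>M) + (1 + 1 / \<delta>) * (\<integral>x. (h x - S n x)\<^sup>2 \<partial>M))
        \<longlonglongrightarrow> (1 + \<delta>) * A"
      by (rule tendsto_eq_intros E A refl | simp)+
    show "\<exists>N. \<forall>n\<ge>N. H \<le> (1 + \<delta>) * (\<integral>x. (S n x)\<^sup>2 \<partial>M) + (1 + 1 / \<delta>) * (\<integral>x. (h x - S n x)\<^sup>2 \<partial>M)"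
      unfolding H_def using integral_square_le_weighted[OF _ _ hi Si that] by auto
  qed
  have 2: "A \<le> (1 + \<delta>) * H" if "0 < \<delta>" for \<delta>
  proof (rule LIMSEQ_le[OF A])
    show "(\<lambda>n. (1 + \<delta>) * H + (1 + 1 / \<delta>) * (\<integral>x. (h x - S n x)\<^sup>2 \<partial>M)) \<longlonglongrightarrow> (1 + \<delta>) * H"
      by (rule tendsto_eq_intros E refl | simp)+
    show "\<exists>N. \<forall>n\<ge>N. (\<integral>x. (S n x)\<^sup>2 \<partial>M) \<le> (1 + \<delta>) * H + (1 + 1 / \<delta>) * (\<integral>x. (h x - S n x)\<^sup>2 \<partial>M)"
    proof (intro exI allI impI)
      fix n
      show "(\<integral>x. (S n x)\<^sup>2 \<partial>M) \<le> (1 + \<delta>) * H + (1 + 1 / \<delta>) * (\<integral>x. (h x - S n x)\<^sup>2 \<partial>M)"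
        unfolding H_def using integral_square_le_weighted[OF _ _ Si hi that, of n]
        by (simp add: power2_commute[of "h _"])
    qed
  qed
  have lim0: "((\<lambda>\<delta>. (1 + \<delta>) * x) \<longlongrightarrow> x) (at_right 0)" for x :: real
    by (rule tendsto_eq_intros refl | simp)+
  have "H \<le> A"
    by (rule tendsto_lowerbound[OF lim0]) (auto simp: eventually_at_right_less 1 intro: eventually_mono[OF eventually_at_right_less])
  moreover have "A \<le> H"
    by (rule tendsto_lowerbound[OF lim0]) (auto simp: eventually_at_right_less 2 intro: eventually_mono[OF eventually_at_right_less])
  ultimately show ?thesis by (simp add: H_def)
qed

lemma (in prob_space) expectation_abs_le_L2:
  fixes f :: "'a \<Rightarrow> real"
  assumes [measurable]: "f \<in> borel_measurable M" and fi: "integrable M (\<lambda>x. (f x)\<^sup>2)"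
  shows "integrable M f" "expectation (\<lambda>x. \<bar>f x\<bar>) \<le> sqrt (expectation (\<lambda>x. (f x)\<^sup>2))"
proof -
  show "integrable M f" by (rule square_integrable_imp_integrable) (use fi in auto)
  then have i: "integrable M (\<lambda>x. \<bar>f x\<bar>)" by simp
  have i2: "integrable M (\<lambda>x. \<bar>f x\<bar>\<^sup>2)" using fi by simp
  have "0 \<le> variance (\<lambda>x. \<bar>f x\<bar>)" by (rule variance_positive)
  then have "(expectation (\<lambda>x. \<bar>f x\<bar>))\<^sup>2 \<le> expectation (\<lambda>x. (f x)\<^sup>2)"
    using variance_eq[OF i i2] by simp
  then show "expectation (\<lambda>x. \<bar>f x\<bar>) \<le> sqrt (expectation (\<lambda>x. (f x)\<^sup>2))"
    by (rule real_le_rsqrt)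
qed

lemma (in prob_space) L2_limit_imp_L1:
  assumes lim: "L2_limit M S h"
    and [measurable]: "\<And>n. S n \<in> borel_measurable M" and Si: "\<And>n. integrable M (\<lambda>x. (S n x)\<^sup>2)"
  shows "integrable M h" "(\<lambda>n. expectation (\<lambda>x. \<bar>h x - S n x\<bar>)) \<longlonglongrightarrow> 0"
proof -
  have [measurable]: "h \<in> borel_measurable M" and hi: "integrable M (\<lambda>x. (h x)\<^sup>2)"
    and E: "(\<lambda>n. \<integral>x. (h x - S n x)\<^sup>2 \<partial>M) \<longlonglongrightarrow> 0"
    using lim by (auto simp: L2_limit_def)
  show "integrable M h" by (rule expectation_abs_le_L2) (use hi in auto)
  have di: "integrable M (\<lambda>x. (h x - S n x)\<^sup>2)" for n
    by (rule integrable_square_diff) (use hi Si in auto)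
  have s: "(\<lambda>n. sqrt (\<integral>x. (h x - S n x)\<^sup>2 \<partial>M)) \<longlonglongrightarrow> 0"
    using tendsto_real_sqrt[OF E] by simp
  show "(\<lambda>n. expectation (\<lambda>x. \<bar>h x - S n x\<bar>)) \<longlonglongrightarrow> 0"
  proof (rule tendsto_sandwich[OF _ _ tendsto_const s])
    show "\<forall>\<^sub>F n in sequentially. expectation (\<lambda>x. \<bar>h x - S n x\<bar>) \<le> sqrt (\<integral>x. (h x - S n x)\<^sup>2 \<partial>M)"
      using expectation_abs_le_L2(2)[OF _ di] by (auto intro!: always_eventually)
  qed (auto intro!: always_eventually)
qed

text \<open>Riesz--Fischer completeness: a mean-square Cauchy sequence is Cauchy in \<open>L\<^sup>1\<close>, hence converges
  almost everywhere along a subsequence, and Fatou's lemma shows that this limit is also the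
  mean-square limit.\<close>

lemma (in prob_space) Riesz_Fischer:
  fixes S :: "nat \<Rightarrow> 'a \<Rightarrow> real"
  assumes [measurable]: "\<And>n. S n \<in> borel_measurable M" and Si: "\<And>n. integrable M (\<lambda>x. (S n x)\<^sup>2)"
    and Cauchy: "\<And>e. 0 < e \<Longrightarrow> \<exists>N. \<forall>i\<ge>N. \<forall>j\<ge>N. (\<integral>x. (S i x - S j x)\<^sup>2 \<partial>M) < e"
  shows "\<exists>h. L2_limit M S h"
proof -
  have di: "integrable M (\<lambda>x. (S i x - S j x)\<^sup>2)" for i j
    by (rule integrable_square_diff) (use Si in auto)
  have int: "integrable M (S n)" for n by (rule expectation_abs_le_L2) (use Si in auto)
  have L1: "\<exists>N. \<forall>i\<ge>N. \<forall>j\<ge>N. (\<integral>x. norm (S i x - S j x) \<partial>M) < e" if "0 < e" for e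
  proof -
    have "0 < e\<^sup>2" using that by simp
    then obtain N where N: "\<And>i j. i \<ge> N \<Longrightarrow> j \<ge> N \<Longrightarrow> (\<integral>x. (S i x - S j x)\<^sup>2 \<partial>M) < e\<^sup>2"
      using Cauchy by blast
    have "(\<integral>x. norm (S i x - S j x) \<partial>M) < e" if ij: "i \<ge> N" "j \<ge> N" for i j
    proof -
      have "(\<integral>x. norm (S i x - S j x) \<partial>M) \<le> sqrt (\<integral>x. (S i x - S j x)\<^sup>2 \<partial>M)"
        using expectation_abs_le_L2(2)[OF _ di] by simp
      also have "\<dots> < sqrt (e\<^sup>2)" by (rule real_sqrt_less_mono[OF N[OF ij]])
      finally show ?thesis using \<open>0 < e\<close> by simp
    qed
    then show ?thesis by blast
  qed
  obtain r where r: "strict_mono r" and ae: "AE x in M. Cauchy (\<lambda>i. S (r i) x)"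
    using cauchy_L1_AE_cauchy_subseq[OF int L1] by blast
  define h where "h = (\<lambda>x. lim (\<lambda>i. S (r i) x))"
  have [measurable]: "h \<in> borel_measurable M" unfolding h_def by measurable
  have conv: "AE x in M. (\<lambda>i. S (r i) x) \<longlonglongrightarrow> h x"
    using ae by eventually_elim (simp add: h_def Cauchy_convergent_iff convergent_LIMSEQ_iff)
  have bound: "\<exists>N. \<forall>n\<ge>N. (\<integral>\<^sup>+x. ennreal ((h x - S n x)\<^sup>2) \<partial>M) \<le> ennreal e" if "0 < e" for e
  proof -
    obtain N where N: "\<And>i j. i \<ge> N \<Longrightarrow> j \<ge> N \<Longrightarrow> (\<integral>x. (S i x - S j x)\<^sup>2 \<partial>M) < e"
      using Cauchy[OF \<open>0 < e\<close>] by auto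
    have "(\<integral>\<^sup>+x. ennreal ((h x - S n x)\<^sup>2) \<partial>M) \<le> ennreal e" if n: "n \<ge> N" for n
    proof -
      have "(\<integral>\<^sup>+x. ennreal ((h x - S n x)\<^sup>2) \<partial>M)
          = (\<integral>\<^sup>+x. liminf (\<lambda>i. ennreal ((S (r i) x - S n x)\<^sup>2)) \<partial>M)"
      proof (rule nn_integral_cong_AE)
        show "AE x in M. ennreal ((h x - S n x)\<^sup>2) = liminf (\<lambda>i. ennreal ((S (r i) x - S n x)\<^sup>2))"
          using conv
        proof eventually_elim
          case (elim x)
          have "(\<lambda>i. ennreal ((S (r i) x - S n x)\<^sup>2)) \<longlonglongrightarrow> ennreal ((h x - S n x)\<^sup>2)"
            by (intro tendsto_ennrealI tendsto_intros elim)
          from lim_imp_Liminf[OF _ this] show ?case by simp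
        qed
      qed
      also have "\<dots> \<le> liminf (\<lambda>i. \<integral>\<^sup>+x. ennreal ((S (r i) x - S n x)\<^sup>2) \<partial>M)"
        by (rule nn_integral_liminf) measurable
      also have "\<dots> \<le> ennreal e"
      proof -
        have "\<forall>\<^sub>F i in sequentially. (\<integral>\<^sup>+x. ennreal ((S (r i) x - S n x)\<^sup>2) \<partial>M) \<le> ennreal e"
          unfolding eventually_sequentially
        proof (intro exI allI impI)
          fix i assume "N \<le> i"
          then have ri: "N \<le> r i" using seq_suble[OF r, of i] by linarith
          have "(\<integral>\<^sup>+x. ennreal ((S (r i) x - S n x)\<^sup>2) \<partial>M) = ennreal (\<integral>x. (S (r i) x - S n x)\<^sup>2 \<partial>M)"
            by (rule nn_integral_eq_integral) (use di in auto)
          then show "(\<integral>\<^sup>+x. ennreal ((S (r i) x - S n x)\<^sup>2) \<partial>M) \<le> ennreal e"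
            using N[OF ri n] by (simp add: ennreal_leI)
        qed
        then show ?thesis by (intro order_trans[OF Liminf_le_Limsup Limsup_bounded]) auto
      qed
      finally show ?thesis .
    qed
    then show ?thesis by blast
  qed
  have fin: "integrable M (\<lambda>x. (h x - S n x)\<^sup>2)"
    if "(\<integral>\<^sup>+x. ennreal ((h x - S n x)\<^sup>2) \<partial>M) \<le> ennreal e" for n e
  proof (rule integrableI_bounded)
    show "(\<integral>\<^sup>+x. ennreal (norm ((h x - S n x)\<^sup>2)) \<partial>M) < \<infinity>"
      using that by (simp add: le_less_trans[OF _ ennreal_less_top])
  qed measurable
  obtain N where "(\<integral>\<^sup>+x. ennreal ((h x - S N x)\<^sup>2) \<partial>M) \<le> ennreal 1"
    using bound[of 1] by auto
  from integrable_square_add[OF _ _ fin[OF this] Si[of N]]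
  have hi: "integrable M (\<lambda>x. (h x)\<^sup>2)" by simp
  have "(\<lambda>n. \<integral>x. (h x - S n x)\<^sup>2 \<partial>M) \<longlonglongrightarrow> 0"
  proof (rule LIMSEQ_I)
    fix e :: real assume "0 < e"
    then obtain N where N: "\<And>n. n \<ge> N \<Longrightarrow> (\<integral>\<^sup>+x. ennreal ((h x - S n x)\<^sup>2) \<partial>M) \<le> ennreal (e / 2)"
      using bound[of "e / 2"] by auto
    have "norm ((\<integral>x. (h x - S n x)\<^sup>2 \<partial>M) - 0) < e" if "n \<ge> N" for n
    proof -
      have "ennreal (\<integral>x. (h x - S n x)\<^sup>2 \<partial>M) \<le> ennreal (e / 2)"
        using N[OF that] nn_integral_eq_integral[OF fin[OF N[OF that]]] by simp
      then have "(\<integral>x. (h x - S n x)\<^sup>2 \<partial>M) \<le> e / 2" using \<open>0 < e\<close> by simp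
      then show ?thesis using \<open>0 < e\<close> by simp
    qed
    then show "\<exists>no. \<forall>n\<ge>no. norm ((\<integral>x. (h x - S n x)\<^sup>2 \<partial>M) - 0) < e" by blast
  qed
  then have "L2_limit M S h" using hi by (simp add: L2_limit_def)
  then show ?thesis by blast
qed

section \<open>The trigonometric system\<close>

definition freq :: "nat \<Rightarrow> real" where
  "freq \<nu> = 2 * pi * real ((Suc \<nu> + 1) div 2)"

text \<open>Sine and cosine differ by a phase of \<open>\<pi>/2\<close>, and a derivative adds another \<open>\<pi>/2\<close>. With the common
  extra phase \<open>p\<close>, the derivatives of all orders of the trigonometric basis are, up to powers of the
  frequency, again systems of this form.\<close>

definition wave :: "real \<Rightarrow> nat \<Rightarrow> real \<Rightarrow> real" where
  "wave p \<nu> t = sqrt 2 * cos (freq \<nu> * t - (if even \<nu> then 0 else pi / 2) + p)"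

lemma trig_basis_eq_wave: "trig_basis (Suc \<nu>) t = wave 0 \<nu> t"
  by (simp add: trig_basis_def wave_def freq_def cos_diff)

lemma trig_eigenvalue_eq_freq: "trig_eigenvalue m (Suc \<nu>) = freq \<nu> ^ (2 * m)"
  by (simp add: trig_eigenvalue_def freq_def)

lemma freq_ge: "real (Suc \<nu>) \<le> freq \<nu>"
proof -
  have "real (Suc \<nu>) \<le> 2 * real ((Suc \<nu> + 1) div 2)" by linarith
  also have "\<dots> \<le> pi * (2 * real ((Suc \<nu> + 1) div 2))"
    using pi_gt3 mult_right_mono[of 1 pi "2 * real ((Suc \<nu> + 1) div 2)"] by simp
  finally show ?thesis by (simp add: freq_def algebra_simps)
qed

lemma freq_ge_1: "1 \<le> freq \<nu>" and freq_pos: "0 < freq \<nu>"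
  using freq_ge[of \<nu>] by auto

lemma wave_DERIV: "(wave p \<nu> has_real_derivative freq \<nu> * wave (p + pi / 2) \<nu> t) (at t within A)"
proof -
  have "cos (freq \<nu> * t - s + (p + pi / 2)) = - sin (freq \<nu> * t - s + p)" for s
    using cos_add[of "freq \<nu> * t - s + p" "pi / 2"] by (simp add: algebra_simps)
  then show ?thesis
    unfolding wave_def by (auto intro!: derivative_eq_intros)
qed

lemma continuous_on_wave [continuous_intros]: "continuous_on A (wave p \<nu>)"
  unfolding wave_def by (intro continuous_intros)

lemma abs_wave_le: "\<bar>wave p \<nu> t\<bar> \<le> sqrt 2"
  unfolding wave_def abs_mult using mult_left_mono[OF abs_cos_le_one, of "sqrt 2"] by simp

lemma integral_cos_period:
  assumes "k \<noteq> (0 :: int)"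
  shows "integral {0..1} (\<lambda>t. cos (2 * pi * of_int k * t + q)) = 0"
proof -
  let ?w = "2 * pi * of_int k :: real"
  have w: "?w \<noteq> 0" using assms by simp
  have "((\<lambda>t. cos (?w * t + q)) has_integral sin (?w * 1 + q) / ?w - sin (?w * 0 + q) / ?w) {0..1}"
  proof (rule fundamental_theorem_of_calculus)
    fix t :: real
    have "((\<lambda>t. sin (?w * t + q) / ?w) has_real_derivative cos (?w * t + q)) (at t within {0..1})"
      using w by (auto intro!: derivative_eq_intros)
    then show "((\<lambda>t. sin (?w * t + q) / ?w) has_vector_derivative cos (?w * t + q)) (at t within {0..1})"
      by (simp add: has_real_derivative_iff_has_vector_derivative)
  qed simp
  moreover have "sin (?w * 1 + q) = sin q"
    using sin_int_2pin[of k] cos_int_2pin[of k] by (simp add: sin_add)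
  ultimately show ?thesis by (simp add: integral_unique)
qed

text \<open>In the product formula for cosines the sum of the two frequencies never vanishes. The difference
  vanishes only within one frequency; there the remaining constant is the cosine of the difference
  of the phases, which is \<open>0\<close> or, up to sign, \<open>\<pi>/2\<close>.\<close>

lemma wave_orthonormal: "integral {0..1} (\<lambda>t. wave p \<nu> t * wave p \<mu> t) = of_bool (\<nu> = \<mu>)"
proof -
  define s where "s = (\<lambda>\<nu>::nat. if even \<nu> then 0 else pi / 2)"
  define k where "k = (\<lambda>\<nu>::nat. int ((Suc \<nu> + 1) div 2))"
  define A where "A = (\<lambda>t. cos (2 * pi * of_int (k \<nu> - k \<mu>) * t + (s \<mu> - s \<nu>)))"
  define B where "B = (\<lambda>t. cos (2 * pi * of_int (k \<nu> + k \<mu>) * t + (2 * p - s \<nu> - s \<mu>)))"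
  have eq: "wave p \<nu> t * wave p \<mu> t = A t + B t" for t
  proof -
    have "wave p \<nu> t * wave p \<mu> t =
      2 * (cos (freq \<nu> * t - s \<nu> + p) * cos (freq \<mu> * t - s \<mu> + p))"
      by (simp add: wave_def s_def)
    also have "\<dots> = cos ((freq \<nu> * t - s \<nu> + p) - (freq \<mu> * t - s \<mu> + p))
        + cos ((freq \<nu> * t - s \<nu> + p) + (freq \<mu> * t - s \<mu> + p))"
      unfolding cos_times_cos by simp
    also have "(freq \<nu> * t - s \<nu> + p) - (freq \<mu> * t - s \<mu> + p) = 2 * pi * of_int (k \<nu> - k \<mu>) * t + (s \<mu> - s \<nu>)"
      by (simp add: freq_def k_def algebra_simps)
    also have "(freq \<nu> * t - s \<nu> + p) + (freq \<mu> * t - s \<mu> + p) = 2 * pi * of_int (k \<nu> + k \<mu>) * t + (2 * p - s \<nu> - s \<mu>)"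
      by (simp add: freq_def k_def algebra_simps)
    finally show ?thesis by (simp add: A_def B_def)
  qed
  have int: "A integrable_on {0..1}" "B integrable_on {0..1}"
    unfolding A_def B_def by (intro integrable_continuous_real continuous_intros)+
  have "k \<nu> + k \<mu> \<noteq> 0" by (simp add: k_def)
  then have B: "integral {0..1} B = 0" unfolding B_def by (rule integral_cos_period)
  have A: "integral {0..1} A = of_bool (\<nu> = \<mu>)"
  proof (cases "k \<nu> = k \<mu>")
    case False
    then have "integral {0..1} A = 0" unfolding A_def by (intro integral_cos_period) simp
    then show ?thesis using False by auto
  next
    case True
    have "A = (\<lambda>t. cos (s \<mu> - s \<nu>))" by (simp add: A_def True)
    then have "integral {0..1} A = cos (s \<mu> - s \<nu>)" by simp
    also have "\<dots> = of_bool (\<nu> = \<mu>)"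
    proof (cases "even \<nu> = even \<mu>")
      case eq: True
      then have "\<nu> = \<mu>" using True unfolding k_def by (auto elim!: evenE oddE)
      then show ?thesis by simp
    next
      case False
      then have "\<nu> \<noteq> \<mu>" by auto
      then show ?thesis using False by (auto simp: s_def)
    qed
    finally show ?thesis .
  qed
  show ?thesis unfolding eq using integral_add[OF int] A B by simp
qed

definition wave_sum :: "(nat \<Rightarrow> real) \<Rightarrow> real \<Rightarrow> nat \<Rightarrow> real \<Rightarrow> real" where
  "wave_sum d p n t = (\<Sum>\<nu><n. d \<nu> * wave p \<nu> t)"

lemma continuous_on_wave_sum [continuous_intros]: "continuous_on A (wave_sum d p n)"
  unfolding wave_sum_def by (intro continuous_intros)

lemma wave_sum_DERIV:
  "(wave_sum d p n has_real_derivative wave_sum (\<lambda>\<nu>. d \<nu> * freq \<nu>) (p + pi / 2) n t) (at t within A)"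
  unfolding wave_sum_def
  by (auto intro!: derivative_eq_intros wave_DERIV sum.cong simp: mult.assoc)

lemma integral_wave_combination_square:
  assumes "finite I"
  shows "integral {0..1} (\<lambda>t. (\<Sum>\<nu>\<in>I. d \<nu> * wave p \<nu> t)\<^sup>2) = (\<Sum>\<nu>\<in>I. (d \<nu>)\<^sup>2)"
proof -
  have eq: "(\<Sum>\<nu>\<in>I. d \<nu> * wave p \<nu> t)\<^sup>2
      = (\<Sum>\<nu>\<in>I. \<Sum>\<mu>\<in>I. (d \<nu> * d \<mu>) * (wave p \<nu> t * wave p \<mu> t))" for t
    unfolding power2_eq_square sum_product by (simp add: ac_simps)
  have int: "(\<lambda>t. (d \<nu> * d \<mu>) * (wave p \<nu> t * wave p \<mu> t)) integrable_on {0..1}" for \<nu> \<mu>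
    by (intro integrable_continuous_real continuous_intros)
  have "integral {0..1} (\<lambda>t. (\<Sum>\<nu>\<in>I. d \<nu> * wave p \<nu> t)\<^sup>2)
      = (\<Sum>\<nu>\<in>I. \<Sum>\<mu>\<in>I. (d \<nu> * d \<mu>) * of_bool (\<nu> = \<mu>))"
    unfolding eq using assms int
    by (simp add: integral_sum integrable_sum wave_orthonormal)
  also have "\<dots> = (\<Sum>\<nu>\<in>I. \<Sum>\<mu>\<in>I. if \<nu> = \<mu> then d \<nu> * d \<mu> else 0)"
    by (intro sum.cong) auto
  finally show ?thesis using assms by (simp add: power2_eq_square)
qed

section \<open>Fourier series in the mean-square sense\<close>

abbreviation unit_measure :: "real measure" where
  "unit_measure \<equiv> restrict_space lborel {0..1}"

lemma prob_space_unit_measure: "prob_space unit_measure"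
  by (rule prob_spaceI) (simp add: emeasure_restrict_space space_restrict_space)

lemma set_integral_unit: "(LBINT t:{0..1}. f t) = (\<integral>t. f t \<partial>unit_measure)" for f :: "real \<Rightarrow> real"
  by (simp add: set_lebesgue_integral_def integral_restrict_space)

lemma set_integrable_unit: "set_integrable lborel {0..1} f \<longleftrightarrow> integrable unit_measure f" for f :: "real \<Rightarrow> real"
  by (simp add: set_integrable_def integrable_restrict_space)

lemma continuous_on_unit_measure:
  fixes f :: "real \<Rightarrow> real"
  assumes "continuous_on {0..1} f"
  shows "f \<in> borel_measurable unit_measure" "integrable unit_measure f"
    "(\<integral>t. f t \<partial>unit_measure) = integral {0..1} f"
proof -
  have i: "set_integrable lborel {0..1} f" by (rule borel_integrable_atLeastAtMost'[OF assms])
  then show "integrable unit_measure f" by (simp add: set_integrable_unit)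
  then show "f \<in> borel_measurable unit_measure" by (rule borel_measurable_integrable)
  show "(\<integral>t. f t \<partial>unit_measure) = integral {0..1} f"
    using set_borel_integral_eq_integral(2)[OF i] by (simp add: set_integral_unit)
qed

lemma wave_sum_unit_measure:
  shows "wave_sum d p n \<in> borel_measurable unit_measure"
    and "integrable unit_measure (wave_sum d p n)"
    and "integrable unit_measure (\<lambda>t. (wave_sum d p n t)\<^sup>2)"
    and "(\<integral>t. (wave_sum d p n t)\<^sup>2 \<partial>unit_measure) = (\<Sum>\<nu><n. (d \<nu>)\<^sup>2)"
proof -
  have c: "continuous_on {0..1} (wave_sum d p n)" "continuous_on {0..1} (\<lambda>t. (wave_sum d p n t)\<^sup>2)"
    by (intro continuous_intros)+
  show "wave_sum d p n \<in> borel_measurable unit_measure" "integrable unit_measure (wave_sum d p n)"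
    using continuous_on_unit_measure[OF c(1)] by auto
  show "integrable unit_measure (\<lambda>t. (wave_sum d p n t)\<^sup>2)"
    using continuous_on_unit_measure[OF c(2)] by auto
  show "(\<integral>t. (wave_sum d p n t)\<^sup>2 \<partial>unit_measure) = (\<Sum>\<nu><n. (d \<nu>)\<^sup>2)"
    using continuous_on_unit_measure(3)[OF c(2)] integral_wave_combination_square[of "{..<n}" d p]
    by (simp add: wave_sum_def)
qed

lemma wave_sum_diff_norm:
  assumes "i \<le> j"
  shows "(\<integral>t. (wave_sum d p j t - wave_sum d p i t)\<^sup>2 \<partial>unit_measure) = (\<Sum>\<nu>\<in>{i..<j}. (d \<nu>)\<^sup>2)"
proof -
  have "wave_sum d p j t - wave_sum d p i t = (\<Sum>\<nu>\<in>{i..<j}. d \<nu> * wave p \<nu> t)" for t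
    unfolding wave_sum_def using sum_diff_nat_ivl[of 0 i j "\<lambda>\<nu>. d \<nu> * wave p \<nu> t"] assms
    by (simp add: atLeast0LessThan)
  moreover have "continuous_on {0..1} (\<lambda>t. (\<Sum>\<nu>\<in>{i..<j}. d \<nu> * wave p \<nu> t)\<^sup>2)"
    by (intro continuous_intros)
  ultimately show ?thesis
    using continuous_on_unit_measure(3) integral_wave_combination_square[of "{i..<j}" d p] by simp
qed

lemma ex_L2_limit_wave_sum:
  assumes d: "summable (\<lambda>\<nu>. (d \<nu>)\<^sup>2)"
  shows "\<exists>h. L2_limit unit_measure (wave_sum d p) h"
proof (rule prob_space.Riesz_Fischer[OF prob_space_unit_measure wave_sum_unit_measure(1,3)])
  fix e :: real assume "0 < e"
  then obtain N where N: "\<And>m n. m \<ge> N \<Longrightarrow> norm (\<Sum>\<nu>\<in>{m..<n}. (d \<nu>)\<^sup>2) < e"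
    using d unfolding summable_Cauchy by blast
  have le: "(\<integral>t. (wave_sum d p j t - wave_sum d p i t)\<^sup>2 \<partial>unit_measure) < e"
    if "N \<le> i" "i \<le> j" for i j
    using N[OF that(1), of j] by (simp add: wave_sum_diff_norm[OF that(2)] sum_nonneg)
  have "(\<integral>t. (wave_sum d p i t - wave_sum d p j t)\<^sup>2 \<partial>unit_measure) < e"
    if "N \<le> i" "N \<le> j" for i j
    using le[of i j] le[of j i] that
    by (cases "i \<le> j") (auto simp: power2_commute[of "wave_sum d p i _"])
  then show "\<exists>N. \<forall>i\<ge>N. \<forall>j\<ge>N. (\<integral>t. (wave_sum d p i t - wave_sum d p j t)\<^sup>2 \<partial>unit_measure) < e"
    by blast
qed

lemma L2_limit_wave_sum_norm:
  assumes "L2_limit unit_measure (wave_sum d p) h" and "summable (\<lambda>\<nu>. (d \<nu>)\<^sup>2)"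
  shows "(\<integral>t. (h t)\<^sup>2 \<partial>unit_measure) = (\<Sum>\<nu>. (d \<nu>)\<^sup>2)"
  using assms by (intro L2_limit_norm[OF assms(1) wave_sum_unit_measure(1,3)])
    (simp add: wave_sum_unit_measure(4) summable_LIMSEQ)

lemma summable_inverse_freq: "summable (\<lambda>\<nu>. 1 / (freq \<nu>)\<^sup>2)"
proof (rule summable_comparison_test')
  show "summable (\<lambda>\<nu>. 1 / (real (Suc \<nu>))\<^sup>2)"
    using inverse_power_summable[of 2, where 'a = real] summable_Suc_iff[of "\<lambda>n. inverse (real n ^ 2)"]
    by (simp add: inverse_eq_divide)
  show "norm (1 / (freq \<nu>)\<^sup>2) \<le> 1 / (real (Suc \<nu>))\<^sup>2" for \<nu>
    using freq_ge[of \<nu>] freq_pos[of \<nu>] by (simp add: frac_le power_mono)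
qed

text \<open>One derivative in mean square makes the coefficients absolutely summable, since
  \<open>2 \<bar>d\<bar> \<le> d\<^sup>2 \<omega>\<^sup>2 + \<omega>\<^sup>-\<^sup>2\<close>.\<close>

lemma summable_abs_coeff:
  assumes "summable (\<lambda>\<nu>. (d \<nu>)\<^sup>2 * (freq \<nu>)\<^sup>2)"
  shows "summable (\<lambda>\<nu>. \<bar>d \<nu>\<bar>)"
proof (rule summable_comparison_test')
  show "summable (\<lambda>\<nu>. (d \<nu>)\<^sup>2 * (freq \<nu>)\<^sup>2 + 1 / (freq \<nu>)\<^sup>2)"
    by (intro summable_add assms summable_inverse_freq)
  fix \<nu>
  define w where "w = freq \<nu>"
  have w: "0 < w" using freq_pos by (simp add: w_def)
  have "0 \<le> (\<bar>d \<nu>\<bar> * w - 1 / w)\<^sup>2" by simp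
  also have "\<dots> = (d \<nu>)\<^sup>2 * w\<^sup>2 + 1 / w\<^sup>2 - 2 * \<bar>d \<nu>\<bar>"
    using w by (simp add: power2_diff power_mult_distrib power_divide)
  finally have "2 * \<bar>d \<nu>\<bar> \<le> (d \<nu>)\<^sup>2 * w\<^sup>2 + 1 / w\<^sup>2" by simp
  then show "norm \<bar>d \<nu>\<bar> \<le> (d \<nu>)\<^sup>2 * (freq \<nu>)\<^sup>2 + 1 / (freq \<nu>)\<^sup>2"
    unfolding w_def by simp
qed

lemma summable_power_freq_mono:
  assumes "summable (\<lambda>\<nu>. (d \<nu>)\<^sup>2 * freq \<nu> ^ l)" and "k \<le> l"
  shows "summable (\<lambda>\<nu>. (d \<nu>)\<^sup>2 * freq \<nu> ^ k)"
proof (rule summable_comparison_test'[OF assms(1)])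
  show "norm ((d \<nu>)\<^sup>2 * freq \<nu> ^ k) \<le> (d \<nu>)\<^sup>2 * freq \<nu> ^ l" for \<nu>
    using power_increasing[OF assms(2) freq_ge_1] freq_pos[of \<nu>]
    by (simp add: abs_mult mult_left_mono)
qed

lemma wave_sum_uniform_limit:
  assumes "summable (\<lambda>\<nu>. \<bar>d \<nu>\<bar>)"
  shows "uniform_limit UNIV (wave_sum d p) (\<lambda>t. \<Sum>\<nu>. d \<nu> * wave p \<nu> t) sequentially"
  unfolding wave_sum_def
proof (rule Weierstrass_m_test)
  show "norm (d \<nu> * wave p \<nu> t) \<le> \<bar>d \<nu>\<bar> * sqrt 2" for \<nu> t
    using abs_wave_le[of p \<nu> t] by (simp add: abs_mult mult_left_mono)
  show "summable (\<lambda>\<nu>. \<bar>d \<nu>\<bar> * sqrt 2)" using assms by (rule summable_mult2)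
qed

lemma wave_series_sums:
  assumes "summable (\<lambda>\<nu>. \<bar>d \<nu>\<bar>)"
  shows "(\<lambda>\<nu>. d \<nu> * wave p \<nu> t) sums (\<Sum>\<nu>. d \<nu> * wave p \<nu> t)"
proof -
  have "summable (\<lambda>\<nu>. d \<nu> * wave p \<nu> t)"
  proof (rule summable_comparison_test')
    show "summable (\<lambda>\<nu>. \<bar>d \<nu>\<bar> * sqrt 2)" using assms by (rule summable_mult2)
    show "norm (d \<nu> * wave p \<nu> t) \<le> \<bar>d \<nu>\<bar> * sqrt 2" for \<nu>
      using abs_wave_le[of p \<nu> t] by (simp add: abs_mult mult_left_mono)
  qed
  then show ?thesis by (rule summable_sums)
qed

lemma continuous_on_wave_series:
  assumes "summable (\<lambda>\<nu>. \<bar>d \<nu>\<bar>)"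
  shows "continuous_on A (\<lambda>t. \<Sum>\<nu>. d \<nu> * wave p \<nu> t)"
proof -
  have "continuous_on UNIV (\<lambda>t. \<Sum>\<nu>. d \<nu> * wave p \<nu> t)"
    by (rule uniform_limit_theorem[OF _ wave_sum_uniform_limit[OF assms]])
       (auto intro!: always_eventually continuous_intros)
  then show ?thesis by (rule continuous_on_subset) simp
qed

lemma L2_limit_wave_series:
  assumes d: "summable (\<lambda>\<nu>. \<bar>d \<nu>\<bar>)"
    and h: "\<And>t. t \<in> {0..1} \<Longrightarrow> (\<lambda>\<nu>. d \<nu> * wave p \<nu> t) sums h t"
  shows "L2_limit unit_measure (wave_sum d p) h"
proof -
  define g where "g = (\<lambda>t. \<Sum>\<nu>. d \<nu> * wave p \<nu> t)"
  have hg: "h t = g t" if "t \<in> {0..1}" for t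
    using h[OF that] by (simp add: g_def sums_unique)
  have "continuous_on {0..1} g" unfolding g_def by (rule continuous_on_wave_series[OF d])
  then have ch: "continuous_on {0..1} h" by (rule continuous_on_eq) (simp add: hg)
  have cd: "continuous_on {0..1} (\<lambda>t. (h t - wave_sum d p n t)\<^sup>2)" for n
    by (intro continuous_intros ch)
  have "(\<lambda>n. \<integral>t. (h t - wave_sum d p n t)\<^sup>2 \<partial>unit_measure) \<longlonglongrightarrow> 0"
  proof (rule LIMSEQ_I)
    fix e :: real assume e: "0 < e"
    define \<delta> where "\<delta> = sqrt (e / 2)"
    have \<delta>: "0 < \<delta>" "\<delta>\<^sup>2 = e / 2" using e by (auto simp: \<delta>_def)
    have "\<forall>\<^sub>F n in sequentially. \<forall>t\<in>UNIV. dist (wave_sum d p n t) (g t) < \<delta>"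
      using uniform_limitD[OF wave_sum_uniform_limit[OF d] \<delta>(1)] unfolding g_def .
    then obtain N where N: "\<And>n t. n \<ge> N \<Longrightarrow> dist (wave_sum d p n t) (g t) < \<delta>"
      unfolding eventually_sequentially by blast
    have "norm ((\<integral>t. (h t - wave_sum d p n t)\<^sup>2 \<partial>unit_measure) - 0) < e" if "n \<ge> N" for n
    proof -
      have "(\<integral>t. (h t - wave_sum d p n t)\<^sup>2 \<partial>unit_measure) \<le> e / 2"
      proof (rule prob_space.integral_le_const[OF prob_space_unit_measure])
        show "integrable unit_measure (\<lambda>t. (h t - wave_sum d p n t)\<^sup>2)"
          by (rule continuous_on_unit_measure(2)[OF cd])
        show "AE t in unit_measure. (h t - wave_sum d p n t)\<^sup>2 \<le> e / 2"
        proof (rule AE_I2)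
          fix t assume "t \<in> space unit_measure"
          then have "t \<in> {0..1}" by (simp add: space_restrict_space)
          then have "\<bar>h t - wave_sum d p n t\<bar> \<le> \<delta>"
            using N[OF \<open>n \<ge> N\<close>, of t] hg[of t] by (simp add: dist_real_def abs_minus_commute)
          then have "\<bar>h t - wave_sum d p n t\<bar>\<^sup>2 \<le> \<delta>\<^sup>2" by (intro power_mono) auto
          then show "(h t - wave_sum d p n t)\<^sup>2 \<le> e / 2" using \<delta> by simp
        qed
      qed
      then show ?thesis using e by simp
    qed
    then show "\<exists>no. \<forall>n\<ge>no. norm ((\<integral>t. (h t - wave_sum d p n t)\<^sup>2 \<partial>unit_measure) - 0) < e" by blast
  qed
  moreover have "continuous_on {0..1} (\<lambda>t. (h t)\<^sup>2)" by (intro continuous_intros ch)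
  then have "integrable unit_measure (\<lambda>t. (h t)\<^sup>2)" by (rule continuous_on_unit_measure)
  ultimately show ?thesis
    using continuous_on_unit_measure(1)[OF ch] by (simp add: L2_limit_def)
qed

section \<open>The penalty in terms of the coefficients\<close>

lemma LBINT_prefix_unit:
  fixes g :: "real \<Rightarrow> real"
  assumes "t \<in> {0..1}"
  shows "(LBINT u:{0..t}. g u) = (\<integral>u. indicator {0..t} u * g u \<partial>unit_measure)"
  using assms unfolding set_lebesgue_integral_def
  by (subst integral_restrict_space)
     (auto intro!: Bochner_Integration.integral_cong simp: indicator_def)

text \<open>Term-by-term differentiation: it suffices that the differentiated series converges in mean
  square, since integration over \<open>[0,t]\<close> is continuous in \<open>L\<^sup>1\<close>.\<close>

lemma wave_series_integral:
  assumes h: "L2_limit unit_measure (wave_sum (\<lambda>\<nu>. d \<nu> * freq \<nu>) (p + pi / 2)) h"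
    and f: "\<And>t. t \<in> {0..1} \<Longrightarrow> (\<lambda>\<nu>. d \<nu> * wave p \<nu> t) sums f t"
    and t: "t \<in> {0..1}"
  shows "f t = f 0 + (LBINT u:{0..t}. h u)"
proof -
  let ?S' = "wave_sum (\<lambda>\<nu>. d \<nu> * freq \<nu>) (p + pi / 2)"
  let ?ind = "indicator {0..t} :: real \<Rightarrow> real"
  note hL1 = prob_space.L2_limit_imp_L1[OF prob_space_unit_measure h wave_sum_unit_measure(1,3)]
  have [measurable]: "{0..t} \<in> sets unit_measure"
    using t by (auto simp: sets_restrict_space_iff)
  have ii: "integrable unit_measure (\<lambda>u. ?ind u * g u)" if "integrable unit_measure g" for g
    using integrable_mult_indicator[of "{0..t}" unit_measure g] that by simp
  have FTC: "wave_sum d p n t = wave_sum d p n 0 + (\<integral>u. ?ind u * ?S' n u \<partial>unit_measure)" for n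
  proof -
    have hi: "(?S' n has_integral (wave_sum d p n t - wave_sum d p n 0)) {0..t}"
      using t wave_sum_DERIV
      by (intro fundamental_theorem_of_calculus)
         (auto simp: has_real_derivative_iff_has_vector_derivative[symmetric])
    have si: "set_integrable lborel {0..t} (?S' n)"
      by (intro borel_integrable_atLeastAtMost' continuous_intros)
    have "(LBINT u:{0..t}. ?S' n u) = wave_sum d p n t - wave_sum d p n 0"
      using set_borel_integral_eq_integral(2)[OF si] integral_unique[OF hi] by simp
    then show ?thesis using LBINT_prefix_unit[OF t] by simp
  qed
  have "(\<lambda>n. (\<integral>u. ?ind u * ?S' n u \<partial>unit_measure) - (\<integral>u. ?ind u * h u \<partial>unit_measure)) \<longlonglongrightarrow> 0"
  proof (rule Lim_null_comparison[OF _ hL1(2)])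
    show "\<forall>\<^sub>F n in sequentially. norm ((\<integral>u. ?ind u * ?S' n u \<partial>unit_measure) - (\<integral>u. ?ind u * h u \<partial>unit_measure))
        \<le> (\<integral>u. \<bar>h u - ?S' n u\<bar> \<partial>unit_measure)"
    proof (intro always_eventually allI)
      fix n
      have i1: "integrable unit_measure (\<lambda>u. h u - ?S' n u)"
        using hL1(1) wave_sum_unit_measure(2) by simp
      have "(\<integral>u. ?ind u * ?S' n u \<partial>unit_measure) - (\<integral>u. ?ind u * h u \<partial>unit_measure)
          = - (\<integral>u. ?ind u * (h u - ?S' n u) \<partial>unit_measure)"
        using ii[OF hL1(1)] ii[OF wave_sum_unit_measure(2)]
        by (simp add: right_diff_distrib)
      then have "norm ((\<integral>u. ?ind u * ?S' n u \<partial>unit_measure) - (\<integral>u. ?ind u * h u \<partial>unit_measure))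
          = norm (\<integral>u. ?ind u * (h u - ?S' n u) \<partial>unit_measure)" by simp
      also have "\<dots> \<le> (\<integral>u. norm (?ind u * (h u - ?S' n u)) \<partial>unit_measure)"
        by (rule integral_norm_bound)
      also have "\<dots> \<le> (\<integral>u. \<bar>h u - ?S' n u\<bar> \<partial>unit_measure)"
      proof (rule integral_mono)
        show "integrable unit_measure (\<lambda>u. norm (?ind u * (h u - ?S' n u)))"
          by (rule integrable_norm[OF ii[OF i1]])
        show "integrable unit_measure (\<lambda>u. \<bar>h u - ?S' n u\<bar>)"
          using i1 by (rule integrable_abs)
      qed (simp add: indicator_def)
      finally show "norm ((\<integral>u. ?ind u * ?S' n u \<partial>unit_measure) - (\<integral>u. ?ind u * h u \<partial>unit_measure))
        \<le> (\<integral>u. \<bar>h u - ?S' n u\<bar> \<partial>unit_measure)" .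
    qed
  qed
  then have "(\<lambda>n. \<integral>u. ?ind u * ?S' n u \<partial>unit_measure) \<longlonglongrightarrow> (\<integral>u. ?ind u * h u \<partial>unit_measure)"
    by (rule LIM_zero_cancel)
  moreover have "(\<lambda>n. wave_sum d p n 0) \<longlonglongrightarrow> f 0"
    using f[of 0] by (simp add: sums_def wave_sum_def)
  ultimately have "(\<lambda>n. wave_sum d p n t) \<longlonglongrightarrow> f 0 + (\<integral>u. ?ind u * h u \<partial>unit_measure)"
    unfolding FTC[of _] by (intro tendsto_add)
  moreover have "(\<lambda>n. wave_sum d p n t) \<longlonglongrightarrow> f t"
    using f[OF t] by (simp add: sums_def wave_sum_def)
  ultimately have "f t = f 0 + (\<integral>u. ?ind u * h u \<partial>unit_measure)"
    by (rule LIMSEQ_unique[rotated])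
  then show ?thesis using LBINT_prefix_unit[OF t] by simp
qed

text \<open>Only the last derivative has to be taken as a mean-square limit. The coefficients of every earlier
  one are absolutely summable, so it is given by its pointwise sum, and the induction differentiates
  one such series at a time.\<close>

lemma has_deriv_I_wave_series:
  assumes "summable (\<lambda>\<nu>. (d \<nu>)\<^sup>2 * freq \<nu> ^ (2 * Suc k))"
    and "\<And>t. t \<in> {0..1} \<Longrightarrow> (\<lambda>\<nu>. d \<nu> * wave p \<nu> t) sums f t"
    and "L2_limit unit_measure (wave_sum (\<lambda>\<nu>. d \<nu> * freq \<nu> ^ Suc k) (p + real (Suc k) * (pi / 2))) h"
  shows "has_deriv_I (Suc k) f h"
  using assms
proof (induction k arbitrary: d p f)
  case 0
  then have h: "L2_limit unit_measure (wave_sum (\<lambda>\<nu>. d \<nu> * freq \<nu>) (p + pi / 2)) h" by simp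
  have "integrable unit_measure h"
    by (rule prob_space.L2_limit_imp_L1(1)[OF prob_space_unit_measure h wave_sum_unit_measure(1,3)])
  then show ?case
    using wave_series_integral[OF h 0(2)]
    unfolding has_deriv_I.simps set_integrable_unit by blast
next
  case (Suc k)
  let ?d' = "\<lambda>\<nu>. d \<nu> * freq \<nu>"
  let ?p' = "p + pi / 2"
  define f' where "f' = (\<lambda>t. \<Sum>\<nu>. ?d' \<nu> * wave ?p' \<nu> t)"
  \<comment> \<open>At least two derivatives remain, so the coefficients of the first are absolutely summable.\<close>
  have "summable (\<lambda>\<nu>. (d \<nu>)\<^sup>2 * freq \<nu> ^ 4)"
    by (rule summable_power_freq_mono[OF Suc.prems(1)]) simp
  then have "summable (\<lambda>\<nu>. (?d' \<nu>)\<^sup>2 * (freq \<nu>)\<^sup>2)"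
    by (simp add: power_mult_distrib mult.assoc power_add[symmetric])
  then have abs: "summable (\<lambda>\<nu>. \<bar>?d' \<nu>\<bar>)" by (rule summable_abs_coeff)
  have f': "(\<lambda>\<nu>. ?d' \<nu> * wave ?p' \<nu> t) sums f' t" for t
    unfolding f'_def by (rule wave_series_sums[OF abs])
  have lim: "L2_limit unit_measure (wave_sum ?d' ?p') f'"
    by (rule L2_limit_wave_series[OF abs f'])
  have "has_deriv_I (Suc k) f' h"
  proof (rule Suc.IH)
    have eq: "(?d' \<nu>)\<^sup>2 * freq \<nu> ^ (2 * Suc k) = (d \<nu>)\<^sup>2 * freq \<nu> ^ (2 * Suc (Suc k))" for \<nu>
      by (simp add: power_mult_distrib power2_eq_square)
    show "summable (\<lambda>\<nu>. (?d' \<nu>)\<^sup>2 * freq \<nu> ^ (2 * Suc k))"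
      unfolding eq by (rule Suc.prems(1))
    show "(\<lambda>\<nu>. ?d' \<nu> * wave ?p' \<nu> t) sums f' t" for t by (rule f')
    have "?p' + real (Suc k) * (pi / 2) = p + real (Suc (Suc k)) * (pi / 2)"
      by (simp add: field_simps)
    moreover have "(\<lambda>\<nu>. ?d' \<nu> * freq \<nu> ^ Suc k) = (\<lambda>\<nu>. d \<nu> * freq \<nu> ^ Suc (Suc k))"
      by (simp add: mult.assoc)
    ultimately show "L2_limit unit_measure (wave_sum (\<lambda>\<nu>. ?d' \<nu> * freq \<nu> ^ Suc k) (?p' + real (Suc k) * (pi / 2))) h"
      using Suc.prems(3) by (simp only:)
  qed
  moreover have "integrable unit_measure f'"
    by (rule prob_space.L2_limit_imp_L1(1)[OF prob_space_unit_measure lim wave_sum_unit_measure(1,3)])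
  ultimately show ?case
    using wave_series_integral[OF lim Suc.prems(2)]
    unfolding has_deriv_I.simps(2)[of "Suc k"] set_integrable_unit by blast
qed

text \<open>The positive and the negative part of \<open>g\<close> are densities of finite measures with the same
  distribution function, hence of the same measure.\<close>

lemma AE_zero_of_prefix_integrals:
  fixes g :: "real \<Rightarrow> real"
  assumes g: "integrable unit_measure g" and zero: "\<And>t. t \<in> {0..1} \<Longrightarrow> (LBINT u:{0..t}. g u) = 0"
  shows "AE t in unit_measure. g t = 0"
proof -
  define G where "G = (\<lambda>u. indicator {0..1} u * g u)"
  have G: "integrable lborel G"
    using g by (simp add: G_def integrable_restrict_space)
  then have [measurable]: "G \<in> borel_measurable borel" by simp
  define P where "P = density lborel (\<lambda>u. ennreal (max 0 (G u)))"
  define Q where "Q = density lborel (\<lambda>u. ennreal (max 0 (- G u)))"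
  have part: "finite_borel_measure (density lborel (\<lambda>u. ennreal (f u)))"
    "cdf (density lborel (\<lambda>u. ennreal (f u))) x = (\<integral>u. indicator {..x} u * f u \<partial>lborel)"
    if f: "integrable lborel f" "\<And>u. 0 \<le> f u" for f x
  proof -
    have [measurable]: "f \<in> borel_measurable borel" using f(1) by simp
    have e: "emeasure (density lborel (\<lambda>u. ennreal (f u))) A = ennreal (\<integral>u. indicator A u * f u \<partial>lborel)"
      if [measurable]: "A \<in> sets borel" for A
    proof -
      have "emeasure (density lborel (\<lambda>u. ennreal (f u))) A = (\<integral>\<^sup>+u. ennreal (indicator A u * f u) \<partial>lborel)"
        by (subst emeasure_density) (auto intro!: nn_integral_cong simp: indicator_def)
      also have "\<dots> = ennreal (\<integral>u. indicator A u * f u \<partial>lborel)"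
        using integrable_mult_indicator[of A lborel f] f by (intro nn_integral_eq_integral) auto
      finally show ?thesis .
    qed
    have "finite_measure (density lborel (\<lambda>u. ennreal (f u)))"
      by (rule finite_measureI) (simp add: e)
    then show "finite_borel_measure (density lborel (\<lambda>u. ennreal (f u)))"
      by (simp add: finite_borel_measure_def finite_borel_measure_axioms_def)
    show "cdf (density lborel (\<lambda>u. ennreal (f u))) x = (\<integral>u. indicator {..x} u * f u \<partial>lborel)"
      unfolding cdf_def measure_def using f by (simp add: e integral_nonneg_AE)
  qed
  have iP: "integrable lborel (\<lambda>u. max 0 (G u))" and iQ: "integrable lborel (\<lambda>u. max 0 (- G u))"
    using G by auto
  have "cdf P x = cdf Q x" for x
  proof -
    have i: "integrable lborel (\<lambda>u. indicator {..x} u * max 0 (G u))"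
      "integrable lborel (\<lambda>u. indicator {..x} u * max 0 (- G u))"
      using integrable_mult_indicator[of "{..x}" lborel, OF _ iP]
        integrable_mult_indicator[of "{..x}" lborel, OF _ iQ] by auto
    have "cdf P x - cdf Q x = (\<integral>u. indicator {..x} u * max 0 (G u) - indicator {..x} u * max 0 (- G u) \<partial>lborel)"
      unfolding P_def Q_def using part(2)[OF iP] part(2)[OF iQ] i by simp
    also have "\<dots> = (\<integral>u. indicator {..x} u * G u \<partial>lborel)"
      by (intro Bochner_Integration.integral_cong) (auto simp: indicator_def)
    also have "\<dots> = 0"
    proof (cases "0 \<le> x")
      case True
      have "indicator {..x} u * G u = indicator {0..min x 1} u * g u" for u
        using True by (auto simp: indicator_def G_def)
      then show ?thesis using zero[of "min x 1"] True by (simp add: set_lebesgue_integral_def)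
    next
      case False
      then have "(\<lambda>u. indicator {..x} u * G u) = (\<lambda>u. 0)"
        by (auto simp: fun_eq_iff indicator_def G_def)
      then show ?thesis by (simp only: integral_zero)
    qed
    finally show ?thesis by simp
  qed
  then have "P = Q"
    using part(1)[OF iP] part(1)[OF iQ] unfolding P_def Q_def by (intro cdf_unique') auto
  then have "AE u in lborel. ennreal (max 0 (G u)) = ennreal (max 0 (- G u))"
    unfolding P_def Q_def by (intro sigma_finite_measure.density_unique lborel.sigma_finite_measure_axioms) auto
  then have "AE u in lborel. G u = 0"
    by eventually_elim (auto simp: max_def split: if_splits)
  then have "AE u in lborel. u \<in> {0..1} \<longrightarrow> g u = 0"
    by eventually_elim (auto simp: G_def)
  then show ?thesis by (subst AE_restrict_space_iff) auto
qed

lemma continuous_AE_zero_imp_zero: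
  fixes u :: "real \<Rightarrow> real"
  assumes c: "continuous_on {0..1} u" and ae: "AE t in unit_measure. u t = 0" and t: "t \<in> {0..1}"
  shows "u t = 0"
proof -
  have ca: "continuous_on {0..1} (\<lambda>t. \<bar>u t\<bar>)" by (intro continuous_intros c)
  have "integral {0..1} (\<lambda>t. \<bar>u t\<bar>) = (\<integral>t. \<bar>u t\<bar> \<partial>unit_measure)"
    by (rule continuous_on_unit_measure(3)[OF ca, symmetric])
  also have "\<dots> = 0" by (rule integral_eq_zero_AE) (use ae in auto)
  finally have "integral {0..1} (\<lambda>t. \<bar>u t\<bar>) = 0" .
  then have "((\<lambda>t. \<bar>u t\<bar>) has_integral 0) (cbox 0 1)"
    using integrable_continuous_real[OF ca] by (simp add: has_integral_iff)
  then have "\<bar>u t\<bar> = 0"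
    by (rule has_integral_0_cbox_imp_0[rotated 2]) (use ca t in auto)
  then show ?thesis by simp
qed

text \<open>Assuming equality only almost everywhere is what makes the induction work. The difference of
  \<open>f1\<close> and \<open>f2\<close> is continuous, being a constant plus an indefinite integral, so it vanishes everywhere;
  therefore all initial integrals of the difference of the first derivatives vanish.\<close>

lemma has_deriv_I_unique_AE:
  assumes "has_deriv_I k f1 g1" "has_deriv_I k f2 g2" "AE t in unit_measure. f1 t = f2 t"
    and "f1 \<in> borel_measurable unit_measure" "f2 \<in> borel_measurable unit_measure"
  shows "(AE t in unit_measure. g1 t = g2 t) \<and>
    g1 \<in> borel_measurable unit_measure \<and> g2 \<in> borel_measurable unit_measure"
  using assms
proof (induction k arbitrary: f1 f2)
  case 0
  have e: "f1 t = g1 t" "f2 t = g2 t" if "t \<in> space unit_measure" for t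
    using 0(1,2) that by (auto simp: space_restrict_space)
  have "AE t in unit_measure. g1 t = g2 t"
    using 0(3) AE_space by eventually_elim (simp add: e[symmetric])
  moreover have "g1 \<in> borel_measurable unit_measure \<longleftrightarrow> f1 \<in> borel_measurable unit_measure"
    "g2 \<in> borel_measurable unit_measure \<longleftrightarrow> f2 \<in> borel_measurable unit_measure"
    by (rule measurable_cong, simp add: e)+
  ultimately show ?case using 0(4,5) by simp
next
  case (Suc k)
  obtain a where a: "integrable unit_measure a" "has_deriv_I k a g1"
    and fa: "\<And>t. t \<in> {0..1} \<Longrightarrow> f1 t = f1 0 + (LBINT u:{0..t}. a u)"
    using Suc.prems(1) unfolding has_deriv_I.simps set_integrable_unit by blast
  obtain b where b: "integrable unit_measure b" "has_deriv_I k b g2"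
    and fb: "\<And>t. t \<in> {0..1} \<Longrightarrow> f2 t = f2 0 + (LBINT u:{0..t}. b u)"
    using Suc.prems(2) unfolding has_deriv_I.simps set_integrable_unit by blast
  have prefix: "set_integrable lborel {0..t} g" if "integrable unit_measure g" "t \<in> {0..1}"
    for g :: "real \<Rightarrow> real" and t
    by (rule set_integrable_subset[where A = "{0..1}"]) (use that in \<open>auto simp: set_integrable_unit\<close>)
  define g where "g = (\<lambda>u. a u - b u)"
  have g: "integrable unit_measure g" using a(1) b(1) by (simp add: g_def)
  define u where "u = (\<lambda>t. f1 0 - f2 0 + integral {0..t} g)"
  have diff: "f1 t - f2 t = u t" if "t \<in> {0..1}" for t
  proof -
    have "f1 t - f2 t = f1 0 - f2 0 + (LBINT u:{0..t}. g u)"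
      using fa[OF that] fb[OF that] set_integral_diff(2)[OF prefix[OF a(1) that] prefix[OF b(1) that]]
      by (simp add: g_def)
    then show ?thesis
      using set_borel_integral_eq_integral(2)[OF prefix[OF g that]] by (simp add: u_def)
  qed
  have "g integrable_on {0..1}"
    using prefix[OF g, of 1] set_borel_integral_eq_integral(1) by auto
  then have "continuous_on {0..1} u"
    unfolding u_def by (intro continuous_intros indefinite_integral_continuous_1)
  moreover have "AE t in unit_measure. u t = 0"
    using Suc.prems(3) AE_space
  proof eventually_elim
    case (elim t)
    then show ?case using diff[of t] by (simp add: space_restrict_space)
  qed
  ultimately have u0: "u t = 0" if "t \<in> {0..1}" for t
    using continuous_AE_zero_imp_zero that by blast
  have "AE t in unit_measure. g t = 0"
  proof (rule AE_zero_of_prefix_integrals[OF g])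
    fix t :: real assume t: "t \<in> {0..1}"
    have "integral {0..t} g = 0" using u0[OF t] u0[of 0] by (simp add: u_def)
    then show "(LBINT u:{0..t}. g u) = 0"
      using set_borel_integral_eq_integral(2)[OF prefix[OF g t]] by simp
  qed
  then have "AE t in unit_measure. a t = b t" by (simp add: g_def)
  then show ?case
    using Suc.IH[OF a(2) b(2)] a(1) b(1) by auto
qed

definition fourier_series :: "(nat \<Rightarrow> real) \<Rightarrow> real \<Rightarrow> real" where
  "fourier_series c t = (\<Sum>\<nu>. c \<nu> * wave 0 \<nu> t)"

definition sobolev_coeff :: "nat \<Rightarrow> (nat \<Rightarrow> real) \<Rightarrow> bool" where
  "sobolev_coeff m c \<longleftrightarrow> summable (\<lambda>\<nu>. (c \<nu>)\<^sup>2 * freq \<nu> ^ (2 * m))"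

definition coeff_penalty :: "nat \<Rightarrow> (nat \<Rightarrow> real) \<Rightarrow> real" where
  "coeff_penalty m c = (\<Sum>\<nu>. (c \<nu>)\<^sup>2 * freq \<nu> ^ (2 * m))"

lemma sobolev_coeff_summable_abs:
  assumes "sobolev_coeff m c" "m \<ge> 1"
  shows "summable (\<lambda>\<nu>. \<bar>c \<nu>\<bar>)"
  by (rule summable_abs_coeff, rule summable_power_freq_mono[of c "2 * m"])
     (use assms in \<open>auto simp: sobolev_coeff_def\<close>)

lemma sobolev_coeff_summable_square:
  assumes "sobolev_coeff m c"
  shows "summable (\<lambda>\<nu>. (c \<nu>)\<^sup>2)"
  using summable_power_freq_mono[of c "2 * m" 0] assms by (simp add: sobolev_coeff_def)

lemma fourier_series_sums:
  assumes "sobolev_coeff m c" "m \<ge> 1"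
  shows "(\<lambda>\<nu>. c \<nu> * wave 0 \<nu> t) sums fourier_series c t"
  unfolding fourier_series_def by (rule wave_series_sums[OF sobolev_coeff_summable_abs[OF assms]])

lemma continuous_on_fourier_series:
  assumes "sobolev_coeff m c" "m \<ge> 1"
  shows "continuous_on A (fourier_series c)"
  using continuous_on_wave_series[OF sobolev_coeff_summable_abs[OF assms]]
  by (simp add: fourier_series_def[abs_def])

lemma mem_sobolev_iff:
  assumes "m \<ge> 1"
  shows "f \<in> sobolev m \<longleftrightarrow> (\<exists>c. sobolev_coeff m c \<and> (\<forall>t\<in>{0..1}. f t = fourier_series c t))"
proof
  assume "f \<in> sobolev m"
  then obtain c where c: "summable (\<lambda>\<nu>. (c (Suc \<nu>))\<^sup>2 * trig_eigenvalue m (Suc \<nu>))"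
    and f: "\<forall>t\<in>{0..1}. (\<lambda>\<nu>. c (Suc \<nu>) * trig_basis (Suc \<nu>) t) sums f t"
    by (auto simp: sobolev_def)
  have "sobolev_coeff m (\<lambda>\<nu>. c (Suc \<nu>))"
    using c by (simp add: sobolev_coeff_def trig_eigenvalue_eq_freq)
  moreover have "f t = fourier_series (\<lambda>\<nu>. c (Suc \<nu>)) t" if "t \<in> {0..1}" for t
    using bspec[OF f that] by (simp add: fourier_series_def trig_basis_eq_wave sums_unique)
  ultimately show "\<exists>c. sobolev_coeff m c \<and> (\<forall>t\<in>{0..1}. f t = fourier_series c t)" by blast
next
  assume "\<exists>c. sobolev_coeff m c \<and> (\<forall>t\<in>{0..1}. f t = fourier_series c t)"
  then obtain c where c: "sobolev_coeff m c" "\<forall>t\<in>{0..1}. f t = fourier_series c t" by blast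
  then show "f \<in> sobolev m"
    using fourier_series_sums[OF c(1) assms]
    unfolding sobolev_def
    by (intro CollectI exI[of _ "\<lambda>\<nu>. c (\<nu> - 1)"])
       (simp add: sobolev_coeff_def trig_basis_eq_wave trig_eigenvalue_eq_freq)
qed

text \<open>By uniqueness almost everywhere, the derivative chosen by \<open>deriv_I\<close> has the same square integral
  as the mean-square limit of the differentiated series.\<close>

lemma J_pen_fourier:
  assumes m: "m \<ge> 1" and c: "sobolev_coeff m c" and f: "\<And>t. t \<in> {0..1} \<Longrightarrow> f t = fourier_series c t"
  shows "J_pen m f = coeff_penalty m c"
proof -
  obtain k where k: "m = Suc k" using m by (cases m) auto
  have sums: "(\<lambda>\<nu>. c \<nu> * wave 0 \<nu> t) sums f t" if "t \<in> {0..1}" for t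
    using fourier_series_sums[OF c m, of t] f[OF that] by simp
  let ?d = "\<lambda>\<nu>. c \<nu> * freq \<nu> ^ m"
  have sq: "(?d \<nu>)\<^sup>2 = (c \<nu>)\<^sup>2 * freq \<nu> ^ (2 * m)" for \<nu>
    by (simp add: power_mult_distrib power_mult[symmetric] mult.commute)
  have d: "summable (\<lambda>\<nu>. (?d \<nu>)\<^sup>2)"
    using c by (simp only: sq sobolev_coeff_def)
  obtain h where h: "L2_limit unit_measure (wave_sum ?d (0 + real m * (pi / 2))) h"
    using ex_L2_limit_wave_sum[OF d] by blast
  have D: "has_deriv_I m f h"
    unfolding k by (rule has_deriv_I_wave_series[OF _ sums]) (use c h in \<open>auto simp: sobolev_coeff_def k\<close>)
  have D': "has_deriv_I m f (deriv_I m f)"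
    unfolding deriv_I_def by (rule someI[where P = "has_deriv_I m f", OF D])
  have "continuous_on {0..1} f"
    by (rule continuous_on_eq[OF continuous_on_fourier_series[OF c m]]) (simp add: f)
  then have fm: "f \<in> borel_measurable unit_measure" by (rule continuous_on_unit_measure)
  have ae: "AE t in unit_measure. deriv_I m f t = h t"
    and [measurable]: "deriv_I m f \<in> borel_measurable unit_measure" "h \<in> borel_measurable unit_measure"
    using has_deriv_I_unique_AE[OF D' D _ fm fm] by auto
  have "J_pen m f = (\<integral>t. deriv_I m f t * deriv_I m f t \<partial>unit_measure)"
    by (simp add: J_form_def set_integral_unit)
  also have "\<dots> = (\<integral>t. (h t)\<^sup>2 \<partial>unit_measure)"
    by (rule integral_cong_AE) (use ae in \<open>auto simp: power2_eq_square\<close>)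
  also have "\<dots> = (\<Sum>\<nu>. (?d \<nu>)\<^sup>2)" by (rule L2_limit_wave_sum_norm[OF h d])
  finally show ?thesis by (simp only: sq coeff_penalty_def)
qed

lemma L2norm_I_fourier:
  assumes m: "m \<ge> 1" and c: "sobolev_coeff m c" and f: "\<And>t. t \<in> {0..1} \<Longrightarrow> f t = fourier_series c t"
  shows "(L2norm_I f)\<^sup>2 = (\<Sum>\<nu>. (c \<nu>)\<^sup>2)"
proof -
  have sums: "(\<lambda>\<nu>. c \<nu> * wave 0 \<nu> t) sums f t" if "t \<in> {0..1}" for t
    using fourier_series_sums[OF c m, of t] f[OF that] by simp
  have "(\<integral>t. (f t)\<^sup>2 \<partial>unit_measure) = (\<Sum>\<nu>. (c \<nu>)\<^sup>2)"
    by (rule L2_limit_wave_sum_norm[OF L2_limit_wave_series[OF sobolev_coeff_summable_abs[OF c m] sums]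
      sobolev_coeff_summable_square[OF c]])
  then show ?thesis
    by (simp add: L2norm_I_def set_integral_unit suminf_nonneg sobolev_coeff_summable_square[OF c])
qed

section \<open>A sampling inequality\<close>

lemma integral_square_Cauchy_Schwarz:
  fixes g :: "real \<Rightarrow> real"
  assumes ab: "a \<le> b" and c: "continuous_on {a..b} g"
  shows "(integral {a..b} g)\<^sup>2 \<le> (b - a) * integral {a..b} (\<lambda>x. (g x)\<^sup>2)"
proof (cases "a = b")
  case False
  define A where "A = integral {a..b} g"
  define B where "B = integral {a..b} (\<lambda>x. (g x)\<^sup>2)"
  have i: "g integrable_on {a..b}" "(\<lambda>x. (g x)\<^sup>2) integrable_on {a..b}"
    by (intro integrable_continuous_real continuous_intros c)+
  have hi: "(g has_integral A) {a..b}" "((\<lambda>x. (g x)\<^sup>2) has_integral B) {a..b}"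
    using i by (auto simp: A_def B_def has_integral_iff)
  have "((\<lambda>x. (b - a)\<^sup>2 * (g x)\<^sup>2 - (2 * (b - a) * A) * g x + A\<^sup>2) has_integral
      (b - a)\<^sup>2 * B - (2 * (b - a) * A) * A + (b - a) * A\<^sup>2) {a..b}"
    using ab has_integral_const_real[of "A\<^sup>2" a b]
    by (intro has_integral_add has_integral_diff has_integral_mult_right hi) simp
  then have "0 \<le> (b - a)\<^sup>2 * B - (2 * (b - a) * A) * A + (b - a) * A\<^sup>2"
  proof (rule has_integral_nonneg)
    fix x
    have "(b - a)\<^sup>2 * (g x)\<^sup>2 - (2 * (b - a) * A) * g x + A\<^sup>2 = ((b - a) * g x - A)\<^sup>2"
      by (simp add: power2_eq_square algebra_simps)
    then show "0 \<le> (b - a)\<^sup>2 * (g x)\<^sup>2 - (2 * (b - a) * A) * g x + A\<^sup>2" by simp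
  qed
  also have "\<dots> = (b - a) * ((b - a) * B - A\<^sup>2)" by (simp add: power2_eq_square algebra_simps)
  finally have "0 \<le> (b - a) * B - A\<^sup>2" using ab False by (simp add: zero_le_mult_iff)
  then show ?thesis by (simp add: A_def B_def)
qed simp

text \<open>On a cell of length \<open>\<delta>\<close>, a function differs from its value at any point of the cell by at most
  \<open>\<surd>\<delta>\<close> times the norm of its derivative.\<close>

lemma cell_sampling:
  fixes u u' :: "real \<Rightarrow> real"
  assumes x0: "x0 \<in> {a..b}" and c: "continuous_on {a..b} u'"
    and der: "\<And>x. x \<in> {a..b} \<Longrightarrow> (u has_real_derivative u' x) (at x within {a..b})"
  shows "integral {a..b} (\<lambda>x. (u x)\<^sup>2) \<le>
    2 * (b - a) * (u x0)\<^sup>2 + 2 * (b - a)\<^sup>2 * integral {a..b} (\<lambda>x. (u' x)\<^sup>2)"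
proof -
  define B where "B = integral {a..b} (\<lambda>x. (u' x)\<^sup>2)"
  have ab: "a \<le> b" using x0 by simp
  have cu: "continuous_on {a..b} u"
    using der by (intro DERIV_continuous_on[of _ u u']) auto
  have c2: "continuous_on {a..b} (\<lambda>x. (u' x)\<^sup>2)" by (intro continuous_intros c)
  have seg: "(u q - u p)\<^sup>2 \<le> (b - a) * B" if "a \<le> p" "p \<le> q" "q \<le> b" for p q
  proof -
    have sub: "{p..q} \<subseteq> {a..b}" using that by auto
    have "(u' has_integral (u q - u p)) {p..q}"
      using that(2) der DERIV_subset[OF _ sub] sub
      by (intro fundamental_theorem_of_calculus)
         (auto simp: has_real_derivative_iff_has_vector_derivative[symmetric])
    then have "u q - u p = integral {p..q} u'" by (simp add: integral_unique)
    then have "(u q - u p)\<^sup>2 \<le> (q - p) * integral {p..q} (\<lambda>x. (u' x)\<^sup>2)"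
      using integral_square_Cauchy_Schwarz[OF that(2) continuous_on_subset[OF c sub]] by simp
    also have "\<dots> \<le> (b - a) * B"
    proof (rule mult_mono)
      show "integral {p..q} (\<lambda>x. (u' x)\<^sup>2) \<le> B"
        unfolding B_def using sub
        by (intro integral_subset_le integrable_continuous_real c2 continuous_on_subset[OF c2 sub]) auto
      show "0 \<le> integral {p..q} (\<lambda>x. (u' x)\<^sup>2)"
        by (intro integral_nonneg integrable_continuous_real continuous_on_subset[OF c2 sub]) auto
    qed (use that in auto)
    finally show ?thesis .
  qed
  have "(u x)\<^sup>2 \<le> 2 * (u x0)\<^sup>2 + 2 * ((b - a) * B)" if "x \<in> {a..b}" for x
  proof -
    have "(u x - u x0)\<^sup>2 \<le> (b - a) * B"
      using seg[of x x0] seg[of x0 x] that x0 by (cases "x \<le> x0") (auto simp: power2_commute)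
    moreover have "(u x)\<^sup>2 + (u x - 2 * u x0)\<^sup>2 = 2 * (u x0)\<^sup>2 + 2 * (u x - u x0)\<^sup>2"
      by (simp add: power2_eq_square algebra_simps)
    ultimately show ?thesis using zero_le_power2[of "u x - 2 * u x0"] by linarith
  qed
  then have "integral {a..b} (\<lambda>x. (u x)\<^sup>2) \<le> integral {a..b} (\<lambda>x. 2 * (u x0)\<^sup>2 + 2 * ((b - a) * B))"
    by (intro integral_le integrable_continuous_real continuous_intros cu) auto
  also have "\<dots> = (b - a) * (2 * (u x0)\<^sup>2 + 2 * ((b - a) * B))" using ab by simp
  also have "\<dots> = 2 * (b - a) * (u x0)\<^sup>2 + 2 * (b - a)\<^sup>2 * B"
    by (simp add: power2_eq_square algebra_simps)
  finally show ?thesis by (simp add: B_def)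
qed

lemma integral_unit_cells:
  fixes u :: "real \<Rightarrow> real"
  assumes c: "continuous_on {0..1} u" and n: "0 < n"
  shows "integral {0..1} u = (\<Sum>i<n. integral {real i / real n..real (Suc i) / real n} u)"
proof -
  have "integral {0..real k / real n} u = (\<Sum>i<k. integral {real i / real n..real (Suc i) / real n} u)"
    if "k \<le> n" for k
    using that
  proof (induction k)
    case (Suc k)
    have "integral {0..real k / real n} u + integral {real k / real n..real (Suc k) / real n} u
        = integral {0..real (Suc k) / real n} u"
    proof (rule Henstock_Kurzweil_Integration.integral_combine)
      show "u integrable_on {0..real (Suc k) / real n}"
        using Suc.prems n
        by (intro integrable_continuous_real continuous_on_subset[OF c]) (auto simp: field_simps)
    qed (use n in \<open>auto simp: field_simps\<close>)
    then show ?case using Suc by simp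
  qed simp
  from this[of n] show ?thesis using n by simp
qed

lemma sampling_first_order:
  assumes n: "0 < n" and \<tau>: "\<And>i. i < n \<Longrightarrow> \<tau> i \<in> {real i / real n..real (Suc i) / real n}"
  shows "(\<Sum>\<nu><M. (c \<nu>)\<^sup>2) \<le> 2 / real n * (\<Sum>i<n. (wave_sum c p M (\<tau> i))\<^sup>2)
    + 2 / (real n)\<^sup>2 * (\<Sum>\<nu><M. (c \<nu> * freq \<nu>)\<^sup>2)"
proof -
  let ?u = "wave_sum c p M"
  let ?u' = "wave_sum (\<lambda>\<nu>. c \<nu> * freq \<nu>) (p + pi / 2) M"
  let ?I = "\<lambda>i. {real i / real n..real (Suc i) / real n}"
  have len: "real (Suc i) / real n - real i / real n = 1 / real n" for i
    by (simp add: diff_divide_distrib[symmetric])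
  have "(\<Sum>\<nu><M. (c \<nu>)\<^sup>2) = integral {0..1} (\<lambda>t. (?u t)\<^sup>2)"
    using integral_wave_combination_square[of "{..<M}" c p] by (simp add: wave_sum_def)
  also have "\<dots> = (\<Sum>i<n. integral (?I i) (\<lambda>t. (?u t)\<^sup>2))"
    by (intro integral_unit_cells continuous_intros n)
  also have "\<dots> \<le> (\<Sum>i<n. 2 * (1 / real n) * (?u (\<tau> i))\<^sup>2 + 2 * (1 / real n)\<^sup>2 * integral (?I i) (\<lambda>t. (?u' t)\<^sup>2))"
  proof (rule sum_mono)
    fix i assume "i \<in> {..<n}"
    then show "integral (?I i) (\<lambda>t. (?u t)\<^sup>2)
        \<le> 2 * (1 / real n) * (?u (\<tau> i))\<^sup>2 + 2 * (1 / real n)\<^sup>2 * integral (?I i) (\<lambda>t. (?u' t)\<^sup>2)"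
      using cell_sampling[OF \<tau>, of i ?u' ?u] wave_sum_DERIV continuous_on_wave_sum
      unfolding len by auto
  qed
  also have "\<dots> = 2 / real n * (\<Sum>i<n. (?u (\<tau> i))\<^sup>2) + 2 / (real n)\<^sup>2 * (\<Sum>i<n. integral (?I i) (\<lambda>t. (?u' t)\<^sup>2))"
    by (simp add: sum.distrib sum_distrib_left power_divide)
  also have "(\<Sum>i<n. integral (?I i) (\<lambda>t. (?u' t)\<^sup>2)) = integral {0..1} (\<lambda>t. (?u' t)\<^sup>2)"
    by (intro integral_unit_cells[symmetric] continuous_intros n)
  also have "\<dots> = (\<Sum>\<nu><M. (c \<nu> * freq \<nu>)\<^sup>2)"
    using integral_wave_combination_square[of "{..<M}" "\<lambda>\<nu>. c \<nu> * freq \<nu>" "p + pi / 2"]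
    by (simp add: wave_sum_def)
  finally show ?thesis .
qed

text \<open>Trades the second power of a frequency for the power \<open>2 m\<close>; the constant \<open>1/4\<close> is small enough to
  be absorbed in the sampling inequality.\<close>

lemma square_le_quarter_plus_power:
  fixes x :: real
  assumes x: "0 \<le> x" and m: "m \<ge> 1"
  shows "x\<^sup>2 \<le> 1 / 4 + 4 ^ (m - 1) * x ^ (2 * m)"
proof (cases "x\<^sup>2 \<le> 1 / 4")
  case True
  then show ?thesis using x by (simp add: add_increasing2)
next
  case False
  have "1 * x\<^sup>2 \<le> (4 * x\<^sup>2) ^ (m - 1) * x\<^sup>2"
    using False by (intro mult_right_mono one_le_power) auto
  also have "\<dots> = 4 ^ (m - 1) * x ^ (2 * m)"
    using m by (cases m) (simp_all add: power_mult_distrib power_mult[symmetric] power_add[symmetric] power2_eq_square mult_2)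
  finally show ?thesis by simp
qed

text \<open>The first-order inequality for a partial sum contains \<open>2 n\<^sup>-\<^sup>2 \<Sum> c\<^sup>2 \<omega>\<^sup>2\<close>. By the preceding bound this is
  at most half of the left-hand side plus a multiple of the penalty of order \<open>m\<close>. The partial sums
  then converge pointwise, which suffices at finitely many points.\<close>

lemma sampling_inequality:
  assumes m: "m \<ge> 1" and c: "sobolev_coeff m c" and n: "0 < n"
    and \<tau>: "\<And>i. i < n \<Longrightarrow> \<tau> i \<in> {real i / real n..real (Suc i) / real n}"
  shows "(\<Sum>\<nu>. (c \<nu>)\<^sup>2) \<le> 4 / real n * (\<Sum>i<n. (fourier_series c (\<tau> i))\<^sup>2)
    + 4 ^ m / real n ^ (2 * m) * coeff_penalty m c"
proof (rule LIMSEQ_le)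
  show "(\<lambda>M. \<Sum>\<nu><M. (c \<nu>)\<^sup>2) \<longlonglongrightarrow> (\<Sum>\<nu>. (c \<nu>)\<^sup>2)"
    by (rule summable_LIMSEQ[OF sobolev_coeff_summable_square[OF c]])
  have "(\<lambda>M. \<Sum>\<nu><M. (c \<nu>)\<^sup>2 * freq \<nu> ^ (2 * m)) \<longlonglongrightarrow> coeff_penalty m c"
    unfolding coeff_penalty_def by (rule summable_LIMSEQ) (use c in \<open>simp add: sobolev_coeff_def\<close>)
  moreover have "(\<lambda>M. wave_sum c 0 M t) \<longlonglongrightarrow> fourier_series c t" for t
    using fourier_series_sums[OF c m, of t] by (simp add: sums_def wave_sum_def)
  ultimately show "(\<lambda>M. 4 / real n * (\<Sum>i<n. (wave_sum c 0 M (\<tau> i))\<^sup>2)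
      + 4 ^ m / real n ^ (2 * m) * (\<Sum>\<nu><M. (c \<nu>)\<^sup>2 * freq \<nu> ^ (2 * m)))
    \<longlonglongrightarrow> 4 / real n * (\<Sum>i<n. (fourier_series c (\<tau> i))\<^sup>2) + 4 ^ m / real n ^ (2 * m) * coeff_penalty m c"
    by (intro tendsto_intros)
  have "(\<Sum>\<nu><M. (c \<nu>)\<^sup>2) \<le> 4 / real n * (\<Sum>i<n. (wave_sum c 0 M (\<tau> i))\<^sup>2)
      + 4 ^ m / real n ^ (2 * m) * (\<Sum>\<nu><M. (c \<nu>)\<^sup>2 * freq \<nu> ^ (2 * m))" for M
  proof -
    define A where "A = (\<Sum>\<nu><M. (c \<nu>)\<^sup>2)"
    define D where "D = (\<Sum>i<n. (wave_sum c 0 M (\<tau> i))\<^sup>2) / real n"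
    define P where "P = (\<Sum>\<nu><M. (c \<nu>)\<^sup>2 * freq \<nu> ^ (2 * m)) / real n ^ (2 * m)"
    have "(\<Sum>\<nu><M. (c \<nu> * freq \<nu>)\<^sup>2) / (real n)\<^sup>2 = (\<Sum>\<nu><M. (c \<nu>)\<^sup>2 * (freq \<nu> / real n)\<^sup>2)"
      by (simp add: sum_divide_distrib power_mult_distrib power_divide)
    also have "\<dots> \<le> (\<Sum>\<nu><M. (c \<nu>)\<^sup>2 * (1 / 4 + 4 ^ (m - 1) * (freq \<nu> / real n) ^ (2 * m)))"
      using freq_pos m by (intro sum_mono mult_left_mono square_le_quarter_plus_power) (auto simp: less_imp_le)
    also have "\<dots> = A / 4 + 4 ^ (m - 1) * P"
      by (simp add: A_def P_def distrib_left sum.distrib sum_divide_distrib sum_distrib_left power_divide mult.left_commute)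
    finally have "(\<Sum>\<nu><M. (c \<nu> * freq \<nu>)\<^sup>2) / (real n)\<^sup>2 \<le> A / 4 + 4 ^ (m - 1) * P" .
    moreover have "A \<le> 2 * D + 2 * ((\<Sum>\<nu><M. (c \<nu> * freq \<nu>)\<^sup>2) / (real n)\<^sup>2)"
      using sampling_first_order[OF n \<tau>, where M = M and c = c and p = 0] by (simp add: A_def D_def)
    ultimately have "A \<le> 4 * D + 4 * 4 ^ (m - 1) * P" by linarith
    also have "4 * 4 ^ (m - 1) = (4 :: real) ^ m" using m by (cases m) auto
    finally show ?thesis by (simp add: A_def D_def P_def)
  qed
  then show "\<exists>N. \<forall>M\<ge>N. (\<Sum>\<nu><M. (c \<nu>)\<^sup>2) \<le> 4 / real n * (\<Sum>i<n. (wave_sum c 0 M (\<tau> i))\<^sup>2)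
      + 4 ^ m / real n ^ (2 * m) * (\<Sum>\<nu><M. (c \<nu>)\<^sup>2 * freq \<nu> ^ (2 * m))" by blast
qed

section \<open>The smoothing spline solves a linear system\<close>

text \<open>Elimination of one variable: if \<open>d\<close> solves the smaller system with the new column as right-hand
  side, then the pivot \<open>p = K\<^sub>k\<^sub>k - \<Sum>\<^sub>j K\<^sub>k\<^sub>j d\<^sub>j\<close> is the value of the quadratic form at \<open>(1, -d)\<close>, hence
  positive.\<close>

lemma positive_definite_solvable:
  fixes K :: "'i \<Rightarrow> 'i \<Rightarrow> real"
  assumes "finite I" and sym: "\<And>i j. K i j = K j i" and \<mu>: "0 < \<mu>"
    and "\<And>x. \<mu> * (\<Sum>i\<in>I. (x i)\<^sup>2) \<le> (\<Sum>i\<in>I. \<Sum>j\<in>I. x i * x j * K i j)"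
  shows "\<exists>a. \<forall>i\<in>I. (\<Sum>j\<in>I. K i j * a j) = y i"
  using assms(1,4)
proof (induction I arbitrary: y rule: finite_induct)
  case (insert k I)
  have pd: "\<mu> * (\<Sum>i\<in>I. (x i)\<^sup>2) \<le> (\<Sum>i\<in>I. \<Sum>j\<in>I. x i * x j * K i j)" for x
  proof -
    define x' where "x' = x(k := 0)"
    have x': "x' k = 0" "\<And>i. i \<in> I \<Longrightarrow> x' i = x i" using insert.hyps by (auto simp: x'_def)
    show ?thesis
      using insert.prems[of x'] insert.hyps x' by (simp cong: sum.cong)
  qed
  obtain b where b: "\<And>i. i \<in> I \<Longrightarrow> (\<Sum>j\<in>I. K i j * b j) = y i"
    using insert.IH[of y] pd by blast
  obtain d where d: "\<And>i. i \<in> I \<Longrightarrow> (\<Sum>j\<in>I. K i j * d j) = K i k"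
    using insert.IH[of "\<lambda>i. K i k"] pd by blast
  define p where "p = K k k - (\<Sum>j\<in>I. K k j * d j)"
  have "0 < p"
  proof -
    define x where "x = (\<lambda>i. if i = k then 1 else - d i)"
    have x: "x k = 1" "\<And>i. i \<in> I \<Longrightarrow> x i = - d i" using insert.hyps by (auto simp: x_def)
    have "\<mu> * 1 \<le> \<mu> * (\<Sum>i\<in>insert k I. (x i)\<^sup>2)"
      using \<mu> insert.hyps x by (intro mult_left_mono) (auto simp: sum_nonneg)
    also have "\<dots> \<le> (\<Sum>i\<in>insert k I. \<Sum>j\<in>insert k I. x i * x j * K i j)" by (rule insert.prems)
    also have "\<dots> = (\<Sum>i\<in>insert k I. x i * (\<Sum>j\<in>insert k I. K i j * x j))"
      by (simp add: sum_distrib_left ac_simps)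
    also have "\<dots> = p + (\<Sum>i\<in>I. x i * (K i k - (\<Sum>j\<in>I. K i j * d j)))"
      using insert.hyps x by (simp add: p_def sum_negf cong: sum.cong)
    also have "\<dots> = p" using d by simp
    finally show ?thesis using \<mu> by simp
  qed
  define t where "t = (y k - (\<Sum>j\<in>I. K k j * b j)) / p"
  define a where "a = (\<lambda>j. if j = k then t else b j - t * d j)"
  have a: "a k = t" "\<And>j. j \<in> I \<Longrightarrow> a j = b j - t * d j" using insert.hyps by (auto simp: a_def)
  have row: "(\<Sum>j\<in>insert k I. K i j * a j) = K i k * t + (\<Sum>j\<in>I. K i j * b j) - t * (\<Sum>j\<in>I. K i j * d j)" for i
  proof -
    have "(\<Sum>j\<in>I. K i j * a j) = (\<Sum>j\<in>I. K i j * b j - t * (K i j * d j))"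
      by (intro sum.cong) (auto simp: a algebra_simps)
    then show ?thesis using insert.hyps a(1) by (simp add: sum_subtractf sum_distrib_left)
  qed
  have "(\<Sum>j\<in>insert k I. K k j * a j) = y k"
  proof -
    have "(\<Sum>j\<in>insert k I. K k j * a j) = t * p + (\<Sum>j\<in>I. K k j * b j)"
      unfolding row p_def by (simp add: algebra_simps)
    then show ?thesis using \<open>0 < p\<close> by (simp add: t_def)
  qed
  moreover have "(\<Sum>j\<in>insert k I. K i j * a j) = y i" if "i \<in> I" for i
    unfolding row using b[OF that] d[OF that] by simp
  ultimately show ?case by (intro exI[of _ a]) blast
qed simp

text \<open>The coefficients of the reproducing kernel at \<open>x\<close>: in the inner product that the penalty
  defines, pairing with it evaluates a function at \<open>x\<close>.\<close>

definition kernel_coeff :: "nat \<Rightarrow> real \<Rightarrow> nat \<Rightarrow> real" where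
  "kernel_coeff m x \<nu> = wave 0 \<nu> x / freq \<nu> ^ (2 * m)"

definition kernel_combination :: "nat \<Rightarrow> 'i set \<Rightarrow> ('i \<Rightarrow> real) \<Rightarrow> ('i \<Rightarrow> real) \<Rightarrow> nat \<Rightarrow> real" where
  "kernel_combination m I x a \<nu> = (\<Sum>i\<in>I. a i * kernel_coeff m (x i) \<nu>)"

lemma sobolev_coeff_kernel:
  assumes "m \<ge> 1"
  shows "sobolev_coeff m (kernel_coeff m x)"
  unfolding sobolev_coeff_def
proof (rule summable_comparison_test')
  show "summable (\<lambda>\<nu>. 2 * (1 / (freq \<nu>)\<^sup>2))" by (intro summable_mult summable_inverse_freq)
  fix \<nu>
  have "\<bar>wave 0 \<nu> x\<bar>\<^sup>2 \<le> (sqrt 2)\<^sup>2" by (intro power_mono abs_wave_le) simp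
  then have w: "(wave 0 \<nu> x)\<^sup>2 \<le> 2" by simp
  have "(freq \<nu>)\<^sup>2 \<le> freq \<nu> ^ (2 * m)"
    using assms by (intro power_increasing freq_ge_1) auto
  then have "(wave 0 \<nu> x)\<^sup>2 / freq \<nu> ^ (2 * m) \<le> 2 / (freq \<nu>)\<^sup>2"
    using w freq_pos[of \<nu>] by (intro frac_le) auto
  moreover have "(kernel_coeff m x \<nu>)\<^sup>2 * freq \<nu> ^ (2 * m) = (wave 0 \<nu> x)\<^sup>2 / freq \<nu> ^ (2 * m)"
    using freq_pos[of \<nu>] by (simp add: kernel_coeff_def power_divide power2_eq_square)
  ultimately show "norm ((kernel_coeff m x \<nu>)\<^sup>2 * freq \<nu> ^ (2 * m)) \<le> 2 * (1 / (freq \<nu>)\<^sup>2)"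
    using freq_pos[of \<nu>] by simp
qed

lemma sobolev_coeff_add:
  assumes "sobolev_coeff m c" "sobolev_coeff m d"
  shows "sobolev_coeff m (\<lambda>\<nu>. c \<nu> + d \<nu>)"
  unfolding sobolev_coeff_def
proof (rule summable_comparison_test')
  show "summable (\<lambda>\<nu>. 2 * ((c \<nu>)\<^sup>2 * freq \<nu> ^ (2 * m)) + 2 * ((d \<nu>)\<^sup>2 * freq \<nu> ^ (2 * m)))"
    using assms unfolding sobolev_coeff_def by (intro summable_add summable_mult)
  fix \<nu>
  have "(c \<nu> + d \<nu>)\<^sup>2 + (c \<nu> - d \<nu>)\<^sup>2 = 2 * (c \<nu>)\<^sup>2 + 2 * (d \<nu>)\<^sup>2"
    by (simp add: power2_eq_square algebra_simps)
  then have "(c \<nu> + d \<nu>)\<^sup>2 \<le> 2 * (c \<nu>)\<^sup>2 + 2 * (d \<nu>)\<^sup>2"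
    using zero_le_power2[of "c \<nu> - d \<nu>"] by linarith
  then have "(c \<nu> + d \<nu>)\<^sup>2 * freq \<nu> ^ (2 * m) \<le> (2 * (c \<nu>)\<^sup>2 + 2 * (d \<nu>)\<^sup>2) * freq \<nu> ^ (2 * m)"
    using freq_pos[of \<nu>] by (intro mult_right_mono) auto
  then show "norm ((c \<nu> + d \<nu>)\<^sup>2 * freq \<nu> ^ (2 * m)) \<le> 2 * ((c \<nu>)\<^sup>2 * freq \<nu> ^ (2 * m)) + 2 * ((d \<nu>)\<^sup>2 * freq \<nu> ^ (2 * m))"
    using freq_pos[of \<nu>] by (simp add: distrib_right)
qed

lemma sobolev_coeff_scale: "sobolev_coeff m c \<Longrightarrow> sobolev_coeff m (\<lambda>\<nu>. r * c \<nu>)"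
  unfolding sobolev_coeff_def using summable_mult[of "\<lambda>\<nu>. (c \<nu>)\<^sup>2 * freq \<nu> ^ (2 * m)" "r\<^sup>2"]
  by (simp add: power_mult_distrib mult.assoc)

lemma sobolev_coeff_diff:
  "sobolev_coeff m c \<Longrightarrow> sobolev_coeff m d \<Longrightarrow> sobolev_coeff m (\<lambda>\<nu>. c \<nu> - d \<nu>)"
  using sobolev_coeff_add[of m c "\<lambda>\<nu>. (- 1) * d \<nu>"] sobolev_coeff_scale[of m d "- 1"] by simp

lemma sobolev_coeff_kernel_combination:
  assumes "m \<ge> 1" "finite I"
  shows "sobolev_coeff m (kernel_combination m I x a)"
  using assms(2)
proof (induction I rule: finite_induct)
  case empty
  then show ?case by (simp add: kernel_combination_def[abs_def] sobolev_coeff_def)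
next
  case (insert i I)
  have "kernel_combination m (insert i I) x a = (\<lambda>\<nu>. a i * kernel_coeff m (x i) \<nu> + kernel_combination m I x a \<nu>)"
    using insert.hyps by (simp add: kernel_combination_def fun_eq_iff)
  then show ?case
    using sobolev_coeff_add[OF sobolev_coeff_scale[OF sobolev_coeff_kernel[OF assms(1)]] insert.IH] by simp
qed

lemma fourier_series_diff:
  assumes "m \<ge> 1" "sobolev_coeff m c" "sobolev_coeff m d"
  shows "fourier_series (\<lambda>\<nu>. c \<nu> - d \<nu>) t = fourier_series c t - fourier_series d t"
proof -
  have "(\<lambda>\<nu>. c \<nu> * wave 0 \<nu> t - d \<nu> * wave 0 \<nu> t) sums (fourier_series c t - fourier_series d t)"
    using assms by (intro sums_diff fourier_series_sums)
  then show ?thesis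
    by (simp add: fourier_series_def left_diff_distrib sums_unique[symmetric])
qed

lemma fourier_series_kernel_combination:
  assumes "m \<ge> 1"
  shows "fourier_series (kernel_combination m I x a) t = (\<Sum>i\<in>I. a i * fourier_series (kernel_coeff m (x i)) t)"
proof -
  have "(\<lambda>\<nu>. \<Sum>i\<in>I. a i * (kernel_coeff m (x i) \<nu> * wave 0 \<nu> t)) sums
      (\<Sum>i\<in>I. a i * fourier_series (kernel_coeff m (x i)) t)"
    by (intro sums_sum sums_mult fourier_series_sums[OF sobolev_coeff_kernel[OF assms] assms])
  then show ?thesis
    by (simp add: fourier_series_def[of "kernel_combination m I x a"] kernel_combination_def
        sum_distrib_right mult.assoc sums_unique[symmetric])
qed

lemma reproducing_property:
  assumes "m \<ge> 1" "sobolev_coeff m e"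
  shows "(\<lambda>\<nu>. kernel_combination m I x a \<nu> * e \<nu> * freq \<nu> ^ (2 * m)) sums
    (\<Sum>i\<in>I. a i * fourier_series e (x i))"
proof -
  have "kernel_combination m I x a \<nu> * e \<nu> * freq \<nu> ^ (2 * m) = (\<Sum>i\<in>I. a i * (e \<nu> * wave 0 \<nu> (x i)))" for \<nu>
    unfolding kernel_combination_def sum_distrib_right using freq_pos[of \<nu>]
    by (intro sum.cong) (auto simp: kernel_coeff_def)
  then show ?thesis
    using assms by (simp only:) (intro sums_sum sums_mult fourier_series_sums)
qed

lemma coeff_penalty_sums: "sobolev_coeff m c \<Longrightarrow> (\<lambda>\<nu>. (c \<nu>)\<^sup>2 * freq \<nu> ^ (2 * m)) sums coeff_penalty m c"
  by (simp add: sobolev_coeff_def coeff_penalty_def summable_sums)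

lemma coeff_penalty_nonneg: "sobolev_coeff m c \<Longrightarrow> 0 \<le> coeff_penalty m c"
  unfolding coeff_penalty_def sobolev_coeff_def using freq_pos by (intro suminf_nonneg) (auto simp: less_imp_le)

lemma coeff_penalty_eq_0_imp:
  assumes "sobolev_coeff m c" "coeff_penalty m c \<le> 0"
  shows "c \<nu> = 0"
proof -
  have "coeff_penalty m c = 0" using assms coeff_penalty_nonneg[OF assms(1)] by simp
  then have "(c \<nu>)\<^sup>2 * freq \<nu> ^ (2 * m) = 0"
    using assms(1) suminf_eq_zero_iff[of "\<lambda>\<nu>. (c \<nu>)\<^sup>2 * freq \<nu> ^ (2 * m)"] freq_pos
    by (simp add: coeff_penalty_def sobolev_coeff_def less_imp_le)
  then show ?thesis using freq_pos[of \<nu>] by simp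
qed

lemma coeff_penalty_diff_le:
  assumes "sobolev_coeff m c" "sobolev_coeff m d"
  shows "coeff_penalty m (\<lambda>\<nu>. c \<nu> - d \<nu>) \<le> 2 * coeff_penalty m c + 2 * coeff_penalty m d"
proof (rule sums_le)
  show "(\<lambda>\<nu>. (c \<nu> - d \<nu>)\<^sup>2 * freq \<nu> ^ (2 * m)) sums coeff_penalty m (\<lambda>\<nu>. c \<nu> - d \<nu>)"
    by (intro coeff_penalty_sums sobolev_coeff_diff assms)
  show "(\<lambda>\<nu>. 2 * ((c \<nu>)\<^sup>2 * freq \<nu> ^ (2 * m)) + 2 * ((d \<nu>)\<^sup>2 * freq \<nu> ^ (2 * m))) sums
      (2 * coeff_penalty m c + 2 * coeff_penalty m d)"
    by (intro sums_add sums_mult coeff_penalty_sums assms)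
  fix \<nu>
  have "(c \<nu> + d \<nu>)\<^sup>2 + (c \<nu> - d \<nu>)\<^sup>2 = 2 * (c \<nu>)\<^sup>2 + 2 * (d \<nu>)\<^sup>2"
    by (simp add: power2_eq_square algebra_simps)
  then have "(c \<nu> - d \<nu>)\<^sup>2 \<le> 2 * (c \<nu>)\<^sup>2 + 2 * (d \<nu>)\<^sup>2"
    using zero_le_power2[of "c \<nu> + d \<nu>"] by linarith
  then have "(c \<nu> - d \<nu>)\<^sup>2 * freq \<nu> ^ (2 * m) \<le> (2 * (c \<nu>)\<^sup>2 + 2 * (d \<nu>)\<^sup>2) * freq \<nu> ^ (2 * m)"
    using freq_pos[of \<nu>] by (intro mult_right_mono) auto
  then show "(c \<nu> - d \<nu>)\<^sup>2 * freq \<nu> ^ (2 * m) \<le> 2 * ((c \<nu>)\<^sup>2 * freq \<nu> ^ (2 * m)) + 2 * ((d \<nu>)\<^sup>2 * freq \<nu> ^ (2 * m))"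
    by (simp add: distrib_right)
qed

definition penalized_loss ::
  "nat \<Rightarrow> real \<Rightarrow> nat \<Rightarrow> (nat \<Rightarrow> real) \<Rightarrow> (nat \<Rightarrow> real) \<Rightarrow> (nat \<Rightarrow> real) \<Rightarrow> real" where
  "penalized_loss m lam n x Y c =
     1 / (2 * real n) * (\<Sum>i=1..n. (Y i - fourier_series c (x i))\<^sup>2) + lam / 2 * coeff_penalty m c"

text \<open>The normal equations make the cross terms of loss and penalty cancel, by the reproducing property.
  The excess over the minimum therefore dominates the penalty of the difference, which gives
  minimality and uniqueness at once.\<close>

lemma penalized_loss_excess:
  fixes a x Y :: "nat \<Rightarrow> real"
  assumes m: "m \<ge> 1" and n: "n \<ge> 1" and c: "sobolev_coeff m c"
  defines "c0 \<equiv> kernel_combination m {1..n} x a"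
  assumes normal: "\<And>i. i \<in> {1..n} \<Longrightarrow> fourier_series c0 (x i) + real n * lam * a i = Y i"
  shows "penalized_loss m lam n x Y c0 + lam / 2 * coeff_penalty m (\<lambda>\<nu>. c \<nu> - c0 \<nu>) \<le> penalized_loss m lam n x Y c"
proof -
  let ?I = "{1..n}"
  define e where "e = (\<lambda>\<nu>. c \<nu> - c0 \<nu>)"
  have c0: "sobolev_coeff m c0" unfolding c0_def by (rule sobolev_coeff_kernel_combination[OF m]) simp
  have e: "sobolev_coeff m e" unfolding e_def by (rule sobolev_coeff_diff[OF c c0])
  define E where "E = (\<lambda>i. fourier_series e (x i))"
  have E: "fourier_series c (x i) = fourier_series c0 (x i) + E i" for i
    using fourier_series_diff[OF m c c0] by (simp add: E_def e_def)
  have "(\<lambda>\<nu>. (c0 \<nu>)\<^sup>2 * freq \<nu> ^ (2 * m) + 2 * (c0 \<nu> * e \<nu> * freq \<nu> ^ (2 * m)) + (e \<nu>)\<^sup>2 * freq \<nu> ^ (2 * m)) sums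
      (coeff_penalty m c0 + 2 * (\<Sum>i\<in>?I. a i * E i) + coeff_penalty m e)"
    unfolding E_def using reproducing_property[OF m e, of ?I x a, folded c0_def]
    by (intro sums_add sums_mult coeff_penalty_sums c0 e)
  moreover have "(c0 \<nu>)\<^sup>2 * freq \<nu> ^ (2 * m) + 2 * (c0 \<nu> * e \<nu> * freq \<nu> ^ (2 * m)) + (e \<nu>)\<^sup>2 * freq \<nu> ^ (2 * m)
      = (c \<nu>)\<^sup>2 * freq \<nu> ^ (2 * m)" for \<nu>
    by (simp add: e_def power2_eq_square algebra_simps)
  ultimately have pen: "coeff_penalty m c = coeff_penalty m c0 + 2 * (\<Sum>i\<in>?I. a i * E i) + coeff_penalty m e"
    using sums_unique2[OF coeff_penalty_sums[OF c]] by simp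
  have "(\<Sum>i\<in>?I. (Y i - fourier_series c (x i))\<^sup>2) =
      (\<Sum>i\<in>?I. (Y i - fourier_series c0 (x i))\<^sup>2 - 2 * real n * lam * (a i * E i) + (E i)\<^sup>2)"
  proof (intro sum.cong refl)
    fix i assume "i \<in> ?I"
    then have r: "Y i = fourier_series c0 (x i) + real n * lam * a i" using normal by simp
    show "(Y i - fourier_series c (x i))\<^sup>2 =
        (Y i - fourier_series c0 (x i))\<^sup>2 - 2 * real n * lam * (a i * E i) + (E i)\<^sup>2"
      unfolding E r by (simp add: power2_eq_square algebra_simps)
  qed
  also have "\<dots> = (\<Sum>i\<in>?I. (Y i - fourier_series c0 (x i))\<^sup>2) - 2 * real n * lam * (\<Sum>i\<in>?I. a i * E i)
      + (\<Sum>i\<in>?I. (E i)\<^sup>2)"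
    by (simp add: sum.distrib sum_subtractf sum_distrib_left)
  finally have loss: "(\<Sum>i\<in>?I. (Y i - fourier_series c (x i))\<^sup>2) = \<dots>" .
  have "penalized_loss m lam n x Y c = penalized_loss m lam n x Y c0 + lam / 2 * coeff_penalty m e
      + 1 / (2 * real n) * (\<Sum>i\<in>?I. (E i)\<^sup>2)"
    unfolding penalized_loss_def loss pen using n by (simp add: field_simps)
  moreover have "0 \<le> 1 / (2 * real n) * (\<Sum>i\<in>?I. (E i)\<^sup>2)" by (simp add: sum_nonneg)
  ultimately show ?thesis unfolding e_def by linarith
qed

text \<open>The matrix of the system is the Gram matrix of the kernel sections, in the inner product of the
  penalty, plus a positive multiple of the identity.\<close>

lemma normal_equations_solvable:
  assumes m: "m \<ge> 1" and n: "n \<ge> 1" and lam: "0 < lam"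
  shows "\<exists>a. \<forall>i\<in>{1..n}. fourier_series (kernel_combination m {1..n} x a) (x i) + real n * lam * a i = Y i"
proof -
  let ?I = "{1..n}"
  define k where "k = (\<lambda>i j. fourier_series (kernel_coeff m (x j)) (x i))"
  define K where "K = (\<lambda>i j. k i j + (if i = j then real n * lam else 0))"
  have sym: "K i j = K j i" for i j
  proof -
    have "k i j = k j i"
      unfolding k_def fourier_series_def kernel_coeff_def by (simp add: mult.commute)
    then show ?thesis by (simp add: K_def)
  qed
  have rowsum: "(\<Sum>j\<in>?I. K i j * a j) = fourier_series (kernel_combination m ?I x a) (x i) + real n * lam * a i"
    if "i \<in> ?I" for i a
  proof -
    have "(\<Sum>j\<in>?I. K i j * a j) = (\<Sum>j\<in>?I. a j * k i j) + (\<Sum>j\<in>?I. if i = j then real n * lam * a j else 0)"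
      unfolding sum.distrib[symmetric] by (intro sum.cong) (auto simp: K_def algebra_simps)
    then show ?thesis
      using that by (simp add: fourier_series_kernel_combination[OF m] k_def)
  qed
  have "\<exists>a. \<forall>i\<in>?I. (\<Sum>j\<in>?I. K i j * a j) = Y i"
  proof (rule positive_definite_solvable[where \<mu> = "real n * lam"])
    fix a :: "nat \<Rightarrow> real"
    let ?c = "kernel_combination m ?I x a"
    have c: "sobolev_coeff m ?c" by (rule sobolev_coeff_kernel_combination[OF m]) simp
    have "(\<lambda>\<nu>. (?c \<nu>)\<^sup>2 * freq \<nu> ^ (2 * m)) sums (\<Sum>i\<in>?I. a i * fourier_series ?c (x i))"
      using reproducing_property[OF m c, of ?I x a] by (simp add: power2_eq_square)
    then have pen: "coeff_penalty m ?c = (\<Sum>i\<in>?I. a i * fourier_series ?c (x i))"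
      using sums_unique2[OF coeff_penalty_sums[OF c]] by simp
    have "(\<Sum>i\<in>?I. \<Sum>j\<in>?I. a i * a j * K i j) = (\<Sum>i\<in>?I. a i * (\<Sum>j\<in>?I. K i j * a j))"
      by (simp add: sum_distrib_left ac_simps)
    also have "\<dots> = (\<Sum>i\<in>?I. a i * (fourier_series ?c (x i) + real n * lam * a i))"
      by (intro sum.cong refl) (simp only: rowsum)
    also have "\<dots> = coeff_penalty m ?c + real n * lam * (\<Sum>i\<in>?I. (a i)\<^sup>2)"
      unfolding pen by (simp add: distrib_left sum.distrib sum_distrib_left power2_eq_square ac_simps)
    finally show "real n * lam * (\<Sum>i\<in>?I. (a i)\<^sup>2) \<le> (\<Sum>i\<in>?I. \<Sum>j\<in>?I. a i * a j * K i j)"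
      using coeff_penalty_nonneg[OF c] by simp
  qed (use sym n lam in auto)
  then show ?thesis using rowsum by simp
qed

text \<open>The solution for general data is the superposition of the solutions for unit vectors.\<close>

lemma spline_solution_linear:
  assumes m: "m \<ge> 1" and n: "n \<ge> 1" and lam: "0 < lam"
  shows "\<exists>B. (\<forall>l. continuous_on {0..1} (B l)) \<and> (\<forall>Y. \<exists>a.
    (\<forall>i\<in>{1..n}. fourier_series (kernel_combination m {1..n} x a) (x i) + real n * lam * a i = Y i) \<and>
    (\<forall>t. fourier_series (kernel_combination m {1..n} x a) t = (\<Sum>l=1..n. Y l * B l t)))"
proof -
  let ?I = "{1..n}"
  let ?F = "\<lambda>a. fourier_series (kernel_combination m ?I x a)"
  have "\<exists>R. \<forall>l. \<forall>i\<in>?I. ?F (R l) (x i) + real n * lam * R l i = of_bool (i = l)"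
    using normal_equations_solvable[OF m n lam, of x "\<lambda>i. of_bool (i = _)"] by (intro choice allI)
  then obtain R where R: "\<And>l i. i \<in> ?I \<Longrightarrow> ?F (R l) (x i) + real n * lam * R l i = of_bool (i = l)"
    by blast
  have comb: "?F (\<lambda>i. \<Sum>l\<in>?I. Y l * R l i) t = (\<Sum>l\<in>?I. Y l * ?F (R l) t)" for Y t
    unfolding fourier_series_kernel_combination[OF m] sum_distrib_left sum_distrib_right
    by (subst sum.swap) (simp add: mult.assoc)
  have "\<exists>a. (\<forall>i\<in>?I. ?F a (x i) + real n * lam * a i = Y i) \<and> (\<forall>t. ?F a t = (\<Sum>l=1..n. Y l * ?F (R l) t))" for Y
  proof (intro exI conjI ballI allI)
    fix i assume i: "i \<in> ?I"
    have "?F (\<lambda>i. \<Sum>l\<in>?I. Y l * R l i) (x i) + real n * lam * (\<Sum>l\<in>?I. Y l * R l i)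
        = (\<Sum>l\<in>?I. Y l * (?F (R l) (x i) + real n * lam * R l i))"
      unfolding comb by (simp add: distrib_left sum.distrib sum_distrib_left ac_simps)
    also have "\<dots> = (\<Sum>l\<in>?I. if i = l then Y l else 0)"
      unfolding R[OF i] by (intro sum.cong) auto
    also have "\<dots> = Y i" using i by simp
    finally show "?F (\<lambda>i. \<Sum>l\<in>?I. Y l * R l i) (x i) + real n * lam * (\<Sum>l\<in>?I. Y l * R l i) = Y i" .
  qed (rule comb)
  moreover have "continuous_on {0..1} (?F (R l))" for l
    by (rule continuous_on_fourier_series[OF sobolev_coeff_kernel_combination[OF m] m]) simp
  ultimately show ?thesis by (intro exI[of _ "\<lambda>l. ?F (R l)"]) blast
qed

section \<open>The divide-and-conquer estimator\<close>

lemma global_index_Suc: "global_index s (Suc i) (Suc j) = i * s + j"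
  by (simp add: global_index_def)

lemma global_index_less:
  assumes "i \<in> {1..n}" "j \<in> {1..s}"
  shows "global_index s i j < s * n"
proof -
  obtain i' j' where ij: "i = Suc i'" "j = Suc j'" "i' < n" "j' < s"
    using assms by (cases i; cases j) auto
  have "i' * s + j' < Suc i' * s" using ij by simp
  also have "\<dots> \<le> n * s" using ij by (intro mult_right_mono) auto
  finally show ?thesis by (simp add: ij global_index_Suc mult.commute)
qed

lemma design_point_in_cell:
  assumes "i < n" "j \<in> {1..s}"
  shows "design_point s n (Suc i) j \<in> {real i / real n..real (Suc i) / real n}"
proof -
  obtain j' where j: "j = Suc j'" "j' < s" using assms by (cases j) auto
  have s: "0 < real s" and n: "0 < real n" using j assms by auto
  have lo: "real i * real s \<le> real (i * s + j')" by simp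
  have hi: "real (i * s + j') \<le> real (Suc i) * real s" using j by (simp add: distrib_right)
  have "real i / real n = real i * real s / (real s * real n)" using s by simp
  also have "\<dots> \<le> real (i * s + j') / (real s * real n)" using lo s n by (intro divide_right_mono) auto
  finally have 1: "real i / real n \<le> design_point s n (Suc i) j"
    by (simp add: design_point_def global_index_Suc j)
  have "real (i * s + j') / (real s * real n) \<le> real (Suc i) * real s / (real s * real n)"
    using hi s n by (intro divide_right_mono) auto
  also have "\<dots> = real (Suc i) / real n" using s by simp
  finally have 2: "design_point s n (Suc i) j \<le> real (Suc i) / real n"
    by (simp add: design_point_def global_index_Suc j)
  show ?thesis using 1 2 by simp
qed

lemma design_point_unit:
  assumes "i \<in> {1..n}" "j \<in> {1..s}"
  shows "design_point s n i j \<in> {0..1}"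
proof -
  obtain i' where i: "i = Suc i'" "i' < n" using assms by (cases i) auto
  have "design_point s n i j \<in> {real i' / real n..real (Suc i') / real n}"
    using design_point_in_cell[OF i(2) assms(2)] i by simp
  moreover have "0 \<le> real i' / real n" "real (Suc i') / real n \<le> 1" using i by auto
  ultimately show ?thesis unfolding atLeastAtMost_iff by linarith
qed

lemma local_objective_eq:
  assumes m: "m \<ge> 1" and j: "j \<in> {1..s}"
    and c: "sobolev_coeff m c" and g: "\<And>t. t \<in> {0..1} \<Longrightarrow> g t = fourier_series c t"
  shows "local_objective m lam s n y j g =
    penalized_loss m lam n (\<lambda>i. design_point s n i j) (\<lambda>i. y (global_index s i j)) c"
proof -
  have "g (design_point s n i j) = fourier_series c (design_point s n i j)" if "i \<in> {1..n}" for i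
    by (rule g[OF design_point_unit[OF that j]])
  moreover have "J_pen m g = coeff_penalty m c" by (rule J_pen_fourier[OF m c g])
  ultimately show ?thesis
    unfolding local_objective_def penalized_loss_def by simp
qed

text \<open>A minimizer that \<open>arg_min\<close> chooses has arbitrary values outside \<open>[0,1]\<close>, but its coefficients are those
  of the explicit solution, because the excess of the loss controls the penalty of the difference.
  The functions \<open>B\<close> come before the data in the order of the quantifiers: this is the linearity.\<close>

lemma sub_estimate_fourier:
  assumes m: "m \<ge> 1" and n: "n \<ge> 1" and lam: "0 < lam" and j: "j \<in> {1..s}"
  shows "\<exists>B. (\<forall>l. continuous_on {0..1} (B l)) \<and> (\<forall>y. \<exists>c. sobolev_coeff m c \<and>
    (\<forall>t\<in>{0..1}. sub_estimate m lam s n y j t = fourier_series c t) \<and>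
    (\<forall>t. fourier_series c t = (\<Sum>i=1..n. y (global_index s i j) * B i t)) \<and>
    (\<forall>d. sobolev_coeff m d \<longrightarrow>
       penalized_loss m lam n (\<lambda>i. design_point s n i j) (\<lambda>i. y (global_index s i j)) c
       \<le> penalized_loss m lam n (\<lambda>i. design_point s n i j) (\<lambda>i. y (global_index s i j)) d))"
proof -
  let ?x = "\<lambda>i. design_point s n i j"
  let ?I = "{1..n}"
  obtain B where B: "\<And>l. continuous_on {0..1} (B l)"
    and sol: "\<And>Y. \<exists>a. (\<forall>i\<in>?I. fourier_series (kernel_combination m ?I ?x a) (?x i) + real n * lam * a i = Y i) \<and>
      (\<forall>t. fourier_series (kernel_combination m ?I ?x a) t = (\<Sum>l=1..n. Y l * B l t))"
    using spline_solution_linear[OF m n lam, of ?x] by blast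
  have "\<exists>c. sobolev_coeff m c \<and> (\<forall>t\<in>{0..1}. sub_estimate m lam s n y j t = fourier_series c t) \<and>
    (\<forall>t. fourier_series c t = (\<Sum>i=1..n. y (global_index s i j) * B i t)) \<and>
    (\<forall>d. sobolev_coeff m d \<longrightarrow>
       penalized_loss m lam n ?x (\<lambda>i. y (global_index s i j)) c
       \<le> penalized_loss m lam n ?x (\<lambda>i. y (global_index s i j)) d)" for y
  proof -
    let ?Y = "\<lambda>i. y (global_index s i j)"
    let ?obj = "local_objective m lam s n y j"
    obtain a where a: "\<And>i. i \<in> ?I \<Longrightarrow> fourier_series (kernel_combination m ?I ?x a) (?x i) + real n * lam * a i = ?Y i"
      and lin: "\<And>t. fourier_series (kernel_combination m ?I ?x a) t = (\<Sum>l=1..n. ?Y l * B l t)"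
      using sol[of ?Y] by blast
    define c0 where "c0 = kernel_combination m ?I ?x a"
    have c0: "sobolev_coeff m c0"
      unfolding c0_def by (rule sobolev_coeff_kernel_combination[OF m]) simp
    have excess: "penalized_loss m lam n ?x ?Y c0 + lam / 2 * coeff_penalty m (\<lambda>\<nu>. d \<nu> - c0 \<nu>)
        \<le> penalized_loss m lam n ?x ?Y d" if "sobolev_coeff m d" for d
      using penalized_loss_excess[OF m n that a] by (simp add: c0_def)
    have min: "penalized_loss m lam n ?x ?Y c0 \<le> penalized_loss m lam n ?x ?Y d" if d: "sobolev_coeff m d" for d
    proof -
      have "0 \<le> lam / 2 * coeff_penalty m (\<lambda>\<nu>. d \<nu> - c0 \<nu>)"
        using lam coeff_penalty_nonneg[OF sobolev_coeff_diff[OF d c0]] by simp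
      then show ?thesis using excess[OF d] by linarith
    qed
    let ?g0 = "fourier_series c0"
    have g0: "?g0 \<in> sobolev m" using mem_sobolev_iff[OF m] c0 by blast
    have "is_arg_min ?obj (\<lambda>g. g \<in> sobolev m) ?g0"
      unfolding is_arg_min_def
    proof (intro conjI notI g0)
      assume "\<exists>g. g \<in> sobolev m \<and> ?obj g < ?obj ?g0"
      then obtain g where g: "g \<in> sobolev m" "?obj g < ?obj ?g0" by blast
      then obtain d where d: "sobolev_coeff m d" "\<And>t. t \<in> {0..1} \<Longrightarrow> g t = fourier_series d t"
        using mem_sobolev_iff[OF m] by blast
      have "?obj ?g0 \<le> ?obj g"
        using min[OF d(1)] local_objective_eq[OF m j c0, of ?g0] local_objective_eq[OF m j d] by simp
      then show False using g(2) by simp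
    qed
    then have arg: "is_arg_min ?obj (\<lambda>g. g \<in> sobolev m) (sub_estimate m lam s n y j)"
      unfolding sub_estimate_def arg_min_def
      by (rule someI[where P = "is_arg_min ?obj (\<lambda>g. g \<in> sobolev m)"])
    then obtain c where c: "sobolev_coeff m c" "\<And>t. t \<in> {0..1} \<Longrightarrow> sub_estimate m lam s n y j t = fourier_series c t"
      unfolding is_arg_min_def mem_sobolev_iff[OF m] by blast
    have "?obj (sub_estimate m lam s n y j) \<le> ?obj ?g0"
      using arg g0 unfolding is_arg_min_def by (meson not_le)
    then have "penalized_loss m lam n ?x ?Y c \<le> penalized_loss m lam n ?x ?Y c0"
      using local_objective_eq[OF m j c0, of ?g0] local_objective_eq[OF m j c] by simp
    then have "lam / 2 * coeff_penalty m (\<lambda>\<nu>. c \<nu> - c0 \<nu>) \<le> 0" using excess[OF c(1)] by linarith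
    then have "coeff_penalty m (\<lambda>\<nu>. c \<nu> - c0 \<nu>) \<le> 0" using lam by (simp add: mult_le_0_iff)
    then have "c = c0"
      using coeff_penalty_eq_0_imp[OF sobolev_coeff_diff[OF c(1) c0]] by fastforce
    then show ?thesis using c0 c(2) min lin unfolding c0_def[symmetric] by (intro exI[of _ c0]) simp
  qed
  then show ?thesis using B by blast
qed

lemma avg_estimate_linear:
  assumes m: "m \<ge> 1" and n: "n \<ge> 1" and lam: "0 < lam"
  shows "\<exists>A. (\<forall>l. continuous_on {0..1} (A l)) \<and>
    (\<forall>y. \<forall>t\<in>{0..1}. avg_estimate m lam s n y t = (\<Sum>l<s * n. y l * A l t))"
proof -
  have "\<exists>B. (\<forall>l. continuous_on {0..1} (B l)) \<and> (\<forall>y. \<forall>t\<in>{0..1}.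
      sub_estimate m lam s n y j t = (\<Sum>i=1..n. y (global_index s i j) * B i t))" if "j \<in> {1..s}" for j
    using sub_estimate_fourier[OF m n lam that] by metis
  then have "\<exists>B. \<forall>j\<in>{1..s}. (\<forall>l. continuous_on {0..1} (B j l)) \<and> (\<forall>y. \<forall>t\<in>{0..1}.
      sub_estimate m lam s n y j t = (\<Sum>i=1..n. y (global_index s i j) * B j i t))"
    by (intro bchoice ballI)
  then obtain B where B: "\<And>j l. j \<in> {1..s} \<Longrightarrow> continuous_on {0..1} (B j l)"
    and sub: "\<And>j y t. j \<in> {1..s} \<Longrightarrow> t \<in> {0..1} \<Longrightarrow>
      sub_estimate m lam s n y j t = (\<Sum>i=1..n. y (global_index s i j) * B j i t)" by blast
  \<comment> \<open>The terms of all pairs with index \<open>l\<close> are collected, so that an exchange of sums takes the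
    place of a bijection between pairs and indices.\<close>
  define A where "A = (\<lambda>l t. 1 / real s * (\<Sum>j=1..s. \<Sum>i=1..n. of_bool (global_index s i j = l) * B j i t))"
  have "avg_estimate m lam s n y t = (\<Sum>l<s * n. y l * A l t)" if t: "t \<in> {0..1}" for y t
  proof -
    have pick: "y (global_index s i j) * B j i t = (\<Sum>l<s * n. y l * (of_bool (global_index s i j = l) * B j i t))"
      if ij: "i \<in> {1..n}" "j \<in> {1..s}" for i j
    proof -
      have "(\<Sum>l<s * n. y l * (of_bool (global_index s i j = l) * B j i t))
          = (\<Sum>l<s * n. if global_index s i j = l then y l * B j i t else 0)"
        by (intro sum.cong) auto
      then show ?thesis using global_index_less[OF ij] by simp
    qed
    have "(\<Sum>j=1..s. sub_estimate m lam s n y j t)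
        = (\<Sum>j=1..s. \<Sum>i=1..n. \<Sum>l<s * n. y l * (of_bool (global_index s i j = l) * B j i t))"
    proof (intro sum.cong refl)
      fix j assume j: "j \<in> {1..s}"
      show "sub_estimate m lam s n y j t
          = (\<Sum>i=1..n. \<Sum>l<s * n. y l * (of_bool (global_index s i j = l) * B j i t))"
        unfolding sub[OF j t] by (intro sum.cong refl pick j)
    qed
    also have "\<dots> = (\<Sum>j=1..s. \<Sum>l<s * n. \<Sum>i=1..n. y l * (of_bool (global_index s i j = l) * B j i t))"
      by (intro sum.cong refl sum.swap)
    also have "\<dots> = (\<Sum>l<s * n. \<Sum>j=1..s. \<Sum>i=1..n. y l * (of_bool (global_index s i j = l) * B j i t))"
      by (rule sum.swap)
    finally show ?thesis
      unfolding avg_estimate_def A_def by (simp only: sum_distrib_left ac_simps)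
  qed
  moreover have "continuous_on {0..1} (A l)" for l
    unfolding A_def using B by (intro continuous_intros) auto
  ultimately show ?thesis by blast
qed

text \<open>On noiseless data the minimizer is compared with the regression function itself, whose data
  misfit is zero: the fit has no larger penalty, and its squared error at the design points is at
  most \<open>\<lambda> J(f)\<close>. The sampling inequality turns this into an \<open>L\<^sup>2\<close> bound.\<close>

lemma sub_estimate_bias:
  assumes m: "m \<ge> 1" and n: "n \<ge> 1" and lam: "0 < lam" and j: "j \<in> {1..s}"
    and f: "f \<in> sobolev_ball m C"
  defines "fhat \<equiv> sub_estimate m lam s n (\<lambda>l. f (real l / real (s * n))) j"
  shows "continuous_on {0..1} fhat"
    and "(L2norm_I (\<lambda>t. f t - fhat t))\<^sup>2 \<le> 4 ^ Suc m * C * (lam + 1 / real n ^ (2 * m))"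
proof -
  let ?x = "\<lambda>i. design_point s n i j"
  let ?Y = "\<lambda>i. f (?x i)"
  let ?q = "1 / real n ^ (2 * m)"
  obtain c where c: "sobolev_coeff m c" and fc: "\<And>t. t \<in> {0..1} \<Longrightarrow> f t = fourier_series c t"
    using f mem_sobolev_iff[OF m] by (auto simp: sobolev_ball_def)
  have pc: "coeff_penalty m c \<le> C" using f J_pen_fourier[OF m c fc] by (simp add: sobolev_ball_def)
  obtain d where d: "sobolev_coeff m d" and fd: "\<And>t. t \<in> {0..1} \<Longrightarrow> fhat t = fourier_series d t"
    and min: "penalized_loss m lam n ?x ?Y d \<le> penalized_loss m lam n ?x ?Y c"
  proof -
    let ?y = "\<lambda>l. f (real l / real (s * n))"
    have Y: "(\<lambda>i. ?y (global_index s i j)) = ?Y" by (simp add: design_point_def)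
    have "\<exists>d. sobolev_coeff m d \<and> (\<forall>t\<in>{0..1}. fhat t = fourier_series d t) \<and>
        (\<forall>c. sobolev_coeff m c \<longrightarrow> penalized_loss m lam n ?x (\<lambda>i. ?y (global_index s i j)) d
          \<le> penalized_loss m lam n ?x (\<lambda>i. ?y (global_index s i j)) c)"
      unfolding fhat_def using sub_estimate_fourier[OF m n lam j] by blast
    then show ?thesis using that c unfolding Y by blast
  qed
  show "continuous_on {0..1} fhat"
    by (rule continuous_on_eq[OF continuous_on_fourier_series[OF d m]]) (simp add: fd)
  have x: "?x i \<in> {0..1}" if "i \<in> {1..n}" for i by (rule design_point_unit[OF that j])
  define e where "e = (\<lambda>\<nu>. c \<nu> - d \<nu>)"
  have e: "sobolev_coeff m e" unfolding e_def by (rule sobolev_coeff_diff[OF c d])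
  have fe: "f t - fhat t = fourier_series e t" if "t \<in> {0..1}" for t
    using fourier_series_diff[OF m c d] fc[OF that] fd[OF that] by (simp add: e_def)
  define D where "D = (\<Sum>i=1..n. (fourier_series e (?x i))\<^sup>2) / real n"
  have "(\<Sum>i=1..n. (?Y i - fourier_series d (?x i))\<^sup>2) = real n * D"
    using n by (simp add: D_def fe[OF x, symmetric] fd[OF x, symmetric])
  moreover have "(\<Sum>i=1..n. (?Y i - fourier_series c (?x i))\<^sup>2) = 0"
    by (simp add: fc[OF x])
  ultimately have *: "D / 2 + lam / 2 * coeff_penalty m d \<le> lam / 2 * coeff_penalty m c"
    using min n by (simp add: penalized_loss_def)
  have D0: "0 \<le> D" by (simp add: D_def sum_nonneg)
  have "0 \<le> lam / 2 * coeff_penalty m d" using lam coeff_penalty_nonneg[OF d] by simp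
  moreover have "lam * coeff_penalty m c \<le> lam * C" using lam pc by simp
  ultimately have DC: "D \<le> lam * C" using * by linarith
  have "lam / 2 * coeff_penalty m d \<le> lam / 2 * coeff_penalty m c" using * D0 by linarith
  then have pd: "coeff_penalty m d \<le> C" using lam pc by simp
  have pe: "coeff_penalty m e \<le> 4 * C"
    using coeff_penalty_diff_le[OF c d] pc pd unfolding e_def by linarith
  have C0: "0 \<le> C" using coeff_penalty_nonneg[OF c] pc by linarith
  have "(L2norm_I (\<lambda>t. f t - fhat t))\<^sup>2 = (\<Sum>\<nu>. (e \<nu>)\<^sup>2)" by (rule L2norm_I_fourier[OF m e fe])
  also have "\<dots> \<le> 4 / real n * (\<Sum>i<n. (fourier_series e (?x (Suc i)))\<^sup>2) + 4 ^ m / real n ^ (2 * m) * coeff_penalty m e"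
    by (rule sampling_inequality[OF m e]) (use n design_point_in_cell[OF _ j] in auto)
  also have "\<dots> = 4 * D + 4 ^ m * ?q * coeff_penalty m e"
    using sum.atLeast1_atMost_eq[of "\<lambda>i. (fourier_series e (?x i))\<^sup>2" n] by (simp add: D_def)
  also have "\<dots> \<le> 4 ^ Suc m * (lam * C) + 4 ^ m * ?q * (4 * C)"
  proof (rule add_mono)
    have "4 * D \<le> 4 * (lam * C)" using DC by simp
    also have "\<dots> \<le> 4 ^ Suc m * (lam * C)"
      using lam C0 by (intro mult_right_mono) (auto simp: one_le_power)
    finally show "4 * D \<le> 4 ^ Suc m * (lam * C)" .
    show "4 ^ m * ?q * coeff_penalty m e \<le> 4 ^ m * ?q * (4 * C)"
      using pe by (intro mult_left_mono) auto
  qed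
  also have "\<dots> = 4 ^ Suc m * C * (lam + ?q)" by (simp add: algebra_simps)
  finally show "(L2norm_I (\<lambda>t. f t - fhat t))\<^sup>2 \<le> 4 ^ Suc m * C * (lam + ?q)" .
qed

lemma L2norm_I_square:
  assumes "continuous_on {0..1} f"
  shows "(L2norm_I f)\<^sup>2 = integral {0..1} (\<lambda>t. (f t)\<^sup>2)"
proof -
  have c: "continuous_on {0..1} (\<lambda>t. (f t)\<^sup>2)" by (intro continuous_intros assms)
  have "(LBINT t:{0..1}. (f t)\<^sup>2) = integral {0..1} (\<lambda>t. (f t)\<^sup>2)"
    unfolding set_integral_unit by (rule continuous_on_unit_measure(3)[OF c])
  moreover have "0 \<le> integral {0..1} (\<lambda>t. (f t)\<^sup>2)"
    by (intro integral_nonneg integrable_continuous_real c) auto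
  ultimately show ?thesis by (simp add: L2norm_I_def)
qed

text \<open>The square of the average bias is at most the average of the squared biases, so the bound for the
  single machines carries over.\<close>

lemma avg_estimate_norm_lower:
  assumes m: "m \<ge> 1" and n: "n \<ge> 1" and s: "s \<ge> 1" and lam: "0 < lam" and f: "f \<in> sobolev_ball m C"
  shows "(L2norm_I f)\<^sup>2 \<le> 2 * test_statistic m lam s n (\<lambda>l. f (real l / real (s * n)))
    + 2 * 4 ^ Suc m * C * (lam + 1 / real n ^ (2 * m))"
proof -
  let ?y = "\<lambda>l. f (real l / real (s * n))"
  let ?g = "\<lambda>j. sub_estimate m lam s n ?y j"
  let ?K = "4 ^ Suc m * C * (lam + 1 / real n ^ (2 * m))"
  let ?h = "avg_estimate m lam s n ?y"
  note bias = sub_estimate_bias[OF m n lam _ f]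
  obtain c where c: "sobolev_coeff m c" and fc: "\<And>t. t \<in> {0..1} \<Longrightarrow> f t = fourier_series c t"
    using f mem_sobolev_iff[OF m] by (auto simp: sobolev_ball_def)
  have cf: "continuous_on {0..1} f"
    by (rule continuous_on_eq[OF continuous_on_fourier_series[OF c m]]) (simp add: fc)
  have cg: "continuous_on {0..1} (?g j)" if "j \<in> {1..s}" for j using bias(1)[OF that] .
  have cd: "continuous_on {0..1} (\<lambda>t. f t - ?g j t)" if "j \<in> {1..s}" for j
    by (intro continuous_intros cf cg that)
  have ch: "continuous_on {0..1} ?h"
    unfolding avg_estimate_def[abs_def] by (intro continuous_intros cg)
  have pw: "(f t)\<^sup>2 \<le> 2 * (?h t)\<^sup>2 + 2 / real s * (\<Sum>j=1..s. (f t - ?g j t)\<^sup>2)" for t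
  proof -
    have "f t - ?h t = (\<Sum>j=1..s. 1 * (f t - ?g j t)) / real s"
      using s by (simp add: avg_estimate_def sum_subtractf field_simps)
    then have "(f t - ?h t)\<^sup>2 = (\<Sum>j=1..s. 1 * (f t - ?g j t))\<^sup>2 / (real s)\<^sup>2" by (simp add: power_divide)
    also have "\<dots> \<le> ((\<Sum>j=1..s. 1\<^sup>2) * (\<Sum>j=1..s. (f t - ?g j t)\<^sup>2)) / (real s)\<^sup>2"
      by (intro divide_right_mono Cauchy_Schwarz_ineq_sum) auto
    also have "\<dots> = (\<Sum>j=1..s. (f t - ?g j t)\<^sup>2) / real s"
      using s by (simp add: power2_eq_square)
    finally have 1: "(f t - ?h t)\<^sup>2 \<le> (\<Sum>j=1..s. (f t - ?g j t)\<^sup>2) / real s" .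
    have "(f t)\<^sup>2 + (f t - 2 * ?h t)\<^sup>2 = 2 * (?h t)\<^sup>2 + 2 * (f t - ?h t)\<^sup>2"
      by (simp add: power2_eq_square algebra_simps)
    moreover have "2 / real s * (\<Sum>j=1..s. (f t - ?g j t)\<^sup>2) = 2 * ((\<Sum>j=1..s. (f t - ?g j t)\<^sup>2) / real s)"
      by simp
    ultimately show ?thesis using 1 zero_le_power2[of "f t - 2 * ?h t"] by linarith
  qed
  have i1: "(\<lambda>t. (?h t)\<^sup>2) integrable_on {0..1}"
    by (intro integrable_continuous_real continuous_intros ch)
  have i2: "(\<lambda>t. (f t - ?g j t)\<^sup>2) integrable_on {0..1}" if "j \<in> {1..s}" for j
    by (intro integrable_continuous_real continuous_on_power cd that)
  have "(L2norm_I f)\<^sup>2 = integral {0..1} (\<lambda>t. (f t)\<^sup>2)" by (rule L2norm_I_square[OF cf])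
  also have "\<dots> \<le> integral {0..1} (\<lambda>t. 2 * (?h t)\<^sup>2 + 2 / real s * (\<Sum>j=1..s. (f t - ?g j t)\<^sup>2))"
    by (intro integral_le integrable_continuous_real continuous_intros cf ch cg pw)
  also have "\<dots> = 2 * integral {0..1} (\<lambda>t. (?h t)\<^sup>2)
      + 2 / real s * (\<Sum>j=1..s. integral {0..1} (\<lambda>t. (f t - ?g j t)\<^sup>2))"
  proof -
    have i3: "(\<lambda>t. \<Sum>j=1..s. (f t - ?g j t)\<^sup>2) integrable_on {0..1}"
      by (intro integrable_sum i2) simp_all
    have "integral {0..1} (\<lambda>t. \<Sum>j=1..s. (f t - ?g j t)\<^sup>2)
        = (\<Sum>j=1..s. integral {0..1} (\<lambda>t. (f t - ?g j t)\<^sup>2))"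
      by (intro integral_sum i2) simp_all
    then show ?thesis
      using integral_add[OF integrable_on_mult_right[OF i1, of 2] integrable_on_mult_right[OF i3, of "2 / real s"]]
      by (simp only: integral_mult_right)
  qed
  also have "\<dots> \<le> 2 * integral {0..1} (\<lambda>t. (?h t)\<^sup>2) + 2 / real s * (\<Sum>j=1..s. ?K)"
  proof (intro add_left_mono mult_left_mono sum_mono)
    fix j assume j: "j \<in> {1..s}"
    show "integral {0..1} (\<lambda>t. (f t - ?g j t)\<^sup>2) \<le> ?K"
      using bias(2)[OF j] L2norm_I_square[OF cd[OF j]] by simp
  qed simp
  also have "\<dots> = 2 * test_statistic m lam s n ?y + 2 * 4 ^ Suc m * C * (lam + 1 / real n ^ (2 * m))"
    using s L2norm_I_square[OF ch] by (simp add: test_statistic_def)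
  finally show ?thesis .
qed

section \<open>Power of the test\<close>

text \<open>The matrix is the Gram matrix in \<open>L\<^sup>2\<close> of the functions that represent the averaged estimator.\<close>

lemma test_statistic_quad_form:
  assumes m: "m \<ge> 1" and n: "n \<ge> 1" and lam: "0 < lam"
  shows "\<exists>G. (\<forall>a b. G a b = G b a) \<and> (\<forall>v. 0 \<le> quad_form (s * n) G v) \<and>
    (\<forall>y. test_statistic m lam s n y = quad_form (s * n) G y)"
proof -
  obtain A where A: "\<And>l. continuous_on {0..1} (A l)"
    and avg: "\<And>y t. t \<in> {0..1} \<Longrightarrow> avg_estimate m lam s n y t = (\<Sum>l<s * n. y l * A l t)"
    using avg_estimate_linear[OF m n lam, of s] by blast
  define G where "G = (\<lambda>a b. integral {0..1} (\<lambda>t. A a t * A b t))"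
  have T: "test_statistic m lam s n y = quad_form (s * n) G y" for y
  proof -
    let ?h = "avg_estimate m lam s n y"
    have "continuous_on {0..1} (\<lambda>t. \<Sum>l<s * n. y l * A l t)" by (intro continuous_intros A)
    then have ch: "continuous_on {0..1} ?h" by (rule continuous_on_eq) (simp add: avg)
    have sq: "(?h t)\<^sup>2 = (\<Sum>a<s * n. \<Sum>b<s * n. (y a * y b) * (A a t * A b t))" if "t \<in> {0..1}" for t
      unfolding avg[OF that] power2_eq_square sum_product by (simp add: ac_simps)
    have i: "(\<lambda>t. (y a * y b) * (A a t * A b t)) integrable_on {0..1}" for a b
      by (intro integrable_continuous_real continuous_intros A)
    have "test_statistic m lam s n y = integral {0..1} (\<lambda>t. (?h t)\<^sup>2)"
      unfolding test_statistic_def by (rule L2norm_I_square[OF ch])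
    also have "\<dots> = integral {0..1} (\<lambda>t. \<Sum>a<s * n. \<Sum>b<s * n. (y a * y b) * (A a t * A b t))"
      by (rule integral_cong) (rule sq)
    also have "\<dots> = (\<Sum>a<s * n. \<Sum>b<s * n. integral {0..1} (\<lambda>t. (y a * y b) * (A a t * A b t)))"
      using i by (simp add: integral_sum integrable_sum)
    also have "\<dots> = quad_form (s * n) G y"
      unfolding quad_form_def G_def by (intro sum.cong refl) (simp add: mult.commute)
    finally show ?thesis .
  qed
  have "0 \<le> quad_form (s * n) G v" for v
    unfolding T[symmetric] test_statistic_def by simp
  moreover have "G a b = G b a" for a b by (simp add: G_def mult.commute)
  ultimately show ?thesis using T by blast
qed

text \<open>The separation constant has two parts: \<open>4\<^sup>m\<^sup>+\<^sup>1 C\<close> pays for the squared bias, and \<open>D\<close> leaves \<open>D \<sigma>\<close> for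
  the power bound.\<close>

lemma signal_dominates:
  assumes m: "m \<ge> 1" and n: "n \<ge> 1" and s: "s \<ge> 1" and lam: "0 < lam" and C: "0 \<le> C" and D: "0 \<le> D"
    and f: "f \<in> sobolev_ball m C" and \<sigma>: "0 \<le> \<sigma>"
    and sep: "sqrt (2 * (D + 4 ^ Suc m * C)) * sqrt (lam + 1 / real n ^ (2 * m) + \<sigma>) \<le> L2norm_I f"
  shows "D * \<sigma> \<le> test_statistic m lam s n (\<lambda>l. f (real l / real (s * n)))"
proof -
  define q where "q = lam + 1 / real n ^ (2 * m)"
  define K where "K = 4 ^ Suc m * C"
  define V where "V = test_statistic m lam s n (\<lambda>l. f (real l / real (s * n)))"
  have q: "0 \<le> q" using lam by (simp add: q_def)
  have K: "0 \<le> K" using C by (simp add: K_def)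
  have "(sqrt (2 * (D + K)) * sqrt (q + \<sigma>))\<^sup>2 \<le> (L2norm_I f)\<^sup>2"
    using sep D K q \<sigma> by (intro power_mono) (auto simp: q_def K_def)
  then have "2 * ((D + K) * (q + \<sigma>)) \<le> (L2norm_I f)\<^sup>2"
    using D K q \<sigma> by (simp add: power_mult_distrib mult.assoc[symmetric])
  also have "\<dots> \<le> 2 * V + 2 * (K * q)"
    using avg_estimate_norm_lower[OF m n s lam f] by (simp add: V_def K_def q_def mult.assoc)
  finally have "(D + K) * (q + \<sigma>) \<le> V + K * q" by linarith
  moreover have "(D + K) * (q + \<sigma>) = D * \<sigma> + (D * q + K * \<sigma>) + K * q" by (simp add: algebra_simps)
  moreover have "0 \<le> D * q + K * \<sigma>" using D q K \<sigma> by simp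
  ultimately show ?thesis unfolding V_def by linarith
qed

theorem theorem4p2:
  fixes m :: nat and C \<alpha> :: real
    and n s :: "nat \<Rightarrow> nat" and lam :: "nat \<Rightarrow> real"
    and M :: "'a measure" and eps :: "nat \<Rightarrow> nat \<Rightarrow> 'a \<Rightarrow> real"
  assumes "m \<ge> 1" and "C > 0" and "0 < \<alpha>" and "\<alpha> < 1"
    and "\<And>N. N \<ge> 1 \<Longrightarrow> n N \<ge> 1 \<and> s N \<ge> 1 \<and> N = s N * n N"
    and "\<And>N. N \<ge> 1 \<Longrightarrow> lam N > 0"
    and "prob_space M"
    and "\<And>N. N \<ge> 1 \<Longrightarrow> iid_std_normal M N (eps N)"
    and "(\<lambda>N. bandwidth m (lam N)) \<longlonglongrightarrow> 0"
    and "filterlim n at_top sequentially"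
    and "\<exists>L :: ereal. (\<lambda>N. ereal (real (n N) * bandwidth m (lam N))) \<longlonglongrightarrow> L"
  shows "\<forall>\<epsilon>>0. \<exists>C\<^sub>\<epsilon>>0. \<exists>N\<^sub>\<epsilon>>0. \<forall>N\<ge>N\<^sub>\<epsilon>.
    (INF f \<in> {f \<in> sobolev_ball m C.
               L2norm_I f \<ge> C\<^sub>\<epsilon> * separation_rate M m (lam N) (s N) (n N) (eps N)}.
       ereal (measure M {\<omega> \<in> space M.
         spline_test M m \<alpha> (lam N) (s N) (n N) (eps N) f \<omega> = 1}))
    \<ge> ereal (1 - \<epsilon>)"
proof (intro allI impI)
  fix \<epsilon> :: real assume \<epsilon>: "0 < \<epsilon>"
  interpret prob_space M by fact
  define z where "z = std_normal_quantile (1 - \<alpha> / 2)"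
  define D where "D = 4 * \<bar>z\<bar> + 32 / \<epsilon> + 1"
  define C\<epsilon> where "C\<epsilon> = sqrt (2 * (D + 4 ^ Suc m * C))"
  have D: "0 < D" using \<epsilon> by (simp add: D_def add_nonneg_pos)
  have power: "1 - \<epsilon> \<le> prob {\<omega> \<in> space M. spline_test M m \<alpha> (lam N) (s N) (n N) (eps N) f \<omega> = 1}"
    if N: "1 \<le> N" and f: "f \<in> sobolev_ball m C"
      and sep: "C\<epsilon> * separation_rate M m (lam N) (s N) (n N) (eps N) \<le> L2norm_I f" for N f
  proof -
    let ?n = "n N" and ?s = "s N" and ?lam = "lam N" and ?e = "eps N"
    have ns: "?n \<ge> 1" "?s \<ge> 1" "N = ?s * ?n" using assms(5)[OF N] by auto
    have lam: "0 < ?lam" using assms(6)[OF N] .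
    have iid: "iid_std_normal M (?s * ?n) ?e" using assms(8)[OF N] ns(3) by simp
    obtain G where sym: "\<And>a b. G a b = G b a" and psd: "\<And>v. 0 \<le> quad_form (?s * ?n) G v"
      and T: "\<And>y. test_statistic m ?lam ?s ?n y = quad_form (?s * ?n) G y"
      using test_statistic_quad_form[OF assms(1) ns(1) lam, of ?s] by blast
    define Q where "Q = (\<lambda>\<omega>. quad_form (?s * ?n) G (\<lambda>l. ?e l \<omega>))"
    define x where "x = (\<lambda>l. f (real l / real (?s * ?n)))"
    have null: "T_stat m ?lam ?s ?n ?e (\<lambda>_. 0) = Q"
      by (simp add: fun_eq_iff T_stat_def T Q_def observations_def[abs_def])
    have alt: "T_stat m ?lam ?s ?n ?e f \<omega> = quad_form (?s * ?n) G (\<lambda>l. x l + ?e l \<omega>)" for \<omega>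
      by (simp add: T_stat_def T x_def observations_def[abs_def])
    have sd: "null_sd M m ?lam ?s ?n ?e = sqrt (variance Q)" by (simp add: null_sd_def null)
    have mean: "null_mean M m ?lam ?s ?n ?e = expectation Q" by (simp add: null_mean_def null)
    have "D * sqrt (variance Q) \<le> quad_form (?s * ?n) G x"
      unfolding x_def T[symmetric]
    proof (rule signal_dominates[OF assms(1) ns(1,2) lam _ _ f])
      show "sqrt (2 * (D + 4 ^ Suc m * C)) * sqrt (?lam + 1 / real ?n ^ (2 * m) + sqrt (variance Q)) \<le> L2norm_I f"
        using sep by (simp only: C\<epsilon>_def separation_rate_def sd)
    qed (use D \<open>0 < C\<close> in auto)
    then have "1 - \<epsilon> \<le> prob {\<omega> \<in> space M. z * sqrt (variance Q) \<le>
        \<bar>quad_form (?s * ?n) G (\<lambda>l. x l + ?e l \<omega>) - expectation Q\<bar>}"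
      unfolding Q_def D_def
      by (rule gaussian_quad_form_power[where G = G and x = x and z = z, OF iid sym psd \<epsilon>])
    moreover have "spline_test M m \<alpha> ?lam ?s ?n ?e f \<omega> = 1 \<longleftrightarrow> z * sqrt (variance Q) \<le>
        \<bar>quad_form (?s * ?n) G (\<lambda>l. x l + ?e l \<omega>) - expectation Q\<bar>" for \<omega>
      by (simp only: spline_test_def alt sd mean z_def of_bool_eq_1_iff)
    ultimately show ?thesis by simp
  qed
  show "\<exists>C\<^sub>\<epsilon>>0. \<exists>N\<^sub>\<epsilon>>0. \<forall>N\<ge>N\<^sub>\<epsilon>.
    (INF f \<in> {f \<in> sobolev_ball m C.
               L2norm_I f \<ge> C\<^sub>\<epsilon> * separation_rate M m (lam N) (s N) (n N) (eps N)}.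
       ereal (measure M {\<omega> \<in> space M.
         spline_test M m \<alpha> (lam N) (s N) (n N) (eps N) f \<omega> = 1}))
    \<ge> ereal (1 - \<epsilon>)"
  proof (intro exI[of _ "C\<epsilon>"] exI[of _ "1 :: nat"] conjI allI impI)
    show "0 < C\<epsilon>" using D \<open>0 < C\<close> by (simp add: C\<epsilon>_def add_pos_pos)
    fix N :: nat assume N: "1 \<le> N"
    show "ereal (1 - \<epsilon>) \<le> (INF f \<in> {f \<in> sobolev_ball m C.
               L2norm_I f \<ge> C\<epsilon> * separation_rate M m (lam N) (s N) (n N) (eps N)}.
       ereal (measure M {\<omega> \<in> space M.
         spline_test M m \<alpha> (lam N) (s N) (n N) (eps N) f \<omega> = 1}))"
      using power[OF N] by (intro INF_greatest) auto
  qed simp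
qed

end
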